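(* Let $X$ be a complex analytic manifold and let $D\subset X$ be a divisor of linear Jacobian type. Then $D$ is strongly Saito-holonomic.
   Context: A divisor is a reduced complex hypersurface; only reduced local equations are considered. Let $n=\dim X$. For $p\in D$ with reduced local equation $f\in\mathcal{O}_{X,p}$ and local coordinates $x_1,\dots,x_n$, let $\{\delta_1,\dots,\delta_m\}$ be a generating set of the module $\mathrm{Der}_{X,p}(-\log D)$ of germs of vector fields $\delta$ at $p$ with $\delta(f)\in(f)$; write $\delta_i(f)=\alpha_i f$, and for $\delta=\sum_j a_j\partial_j$ let $\sigma(\delta)=\sum_j a_j\xi_j\in\mathcal{O}_{X,p}[\xi_1,\dots,\xi_n]$ be its principal symbol. Linear Jacobian type: let $\mathcal{J}_f=(\partial_1(f),\dots,\partial_n(f),f)\subset\mathcal{O}_{X,p}$, let $\mathcal{R}(\mathcal{J}_f)=\bigoplus_{i\ge0}\mathcal{J}_f^i t^i$ be its Rees algebra, and let $\varphi:\mathcal{O}_{X,p}[\xi_1,\dots,\xi_n,s]\to\mathcal{R}(\mathcal{J}_f)$ be the graded $\mathcal{O}_{X,p}$-algebra map with $\xi_i\mapsto\partial_i(f)t$, $s\mapsto ft$. Let $\ker^{(1)}\varphi$ be the ideal generated by the degree-one homogeneous part of $\ker\varphi$ (degree in $\xi_1,\dots,\xi_n,s$), that is, the ideal generated by $\sigma(\delta_i)-\alpha_i s$, $i=1,\dots,m$. $D$ is of linear Jacobian type if $\ker\varphi=\ker^{(1)}\varphi$ (at each $p\in D$). Strong Saito-holonomicity: $D$ is strongly Saito-holonomic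 at $p$ if the ideal $(f,\sigma(\delta_1)-\alpha_1 s,\dots,\sigma(\delta_m)-\alpha_m s)$ has height $n+1$ in $\mathcal{O}_{X,p}[\xi_1,\dots,\xi_n,s]$ (independent of choices), and strongly Saito-holonomic if this holds at each $p\in D$. *)

theory Defs
  imports
    "HOL-Complex_Analysis.Cauchy_Integral_Formula"
    "HOL-Computational_Algebra.Polynomial"
    "HOL-Library.Poly_Mapping"
    "HOL-Library.Extended_Nat"
begin

section \<open>Holomorphic functions of several variables\<close>

definition cdiff_at :: "(complex^'n \<Rightarrow> complex) \<Rightarrow> complex^'n \<Rightarrow> bool" where
  "cdiff_at f z \<longleftrightarrow>
     (\<exists>L. (f has_derivative L) (at z) \<and> (\<forall>c v. L (c *s v) = c * L v))"

definition cpartial :: "'n \<Rightarrow> (complex^'n \<Rightarrow> complex) \<Rightarrow> complex^'n \<Rightarrow> complex" where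
  "cpartial j f z = deriv (\<lambda>t. f (z + t *s axis j 1)) 0"

lemma cdiff_at_const: "cdiff_at (\<lambda>_. c) z"
  unfolding cdiff_at_def by (intro exI[of _ "\<lambda>_. 0"]) auto

lemma cdiff_at_add: "cdiff_at f z \<Longrightarrow> cdiff_at g z \<Longrightarrow> cdiff_at (\<lambda>w. f w + g w) z"
  unfolding cdiff_at_def
  apply (elim exE conjE)
  subgoal for L M
    by (intro exI[of _ "\<lambda>v. L v + M v"] conjI has_derivative_add) (auto simp: algebra_simps)
  done

lemma cdiff_at_uminus: "cdiff_at f z \<Longrightarrow> cdiff_at (\<lambda>w. - f w) z"
  unfolding cdiff_at_def
  apply (elim exE conjE)
  subgoal for L
    by (intro exI[of _ "\<lambda>v. - L v"] conjI has_derivative_minus) (auto simp: algebra_simps)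
  done

lemma cdiff_at_diff: "cdiff_at f z \<Longrightarrow> cdiff_at g z \<Longrightarrow> cdiff_at (\<lambda>w. f w - g w) z"
  using cdiff_at_add[of f z "\<lambda>w. - g w"] cdiff_at_uminus[of g z] by simp

lemma cdiff_at_mult: "cdiff_at f z \<Longrightarrow> cdiff_at g z \<Longrightarrow> cdiff_at (\<lambda>w. f w * g w) z"
  unfolding cdiff_at_def
  apply (elim exE conjE)
  subgoal for L M
    by (intro exI[of _ "\<lambda>v. f z * M v + L v * g z"] conjI has_derivative_mult)
       (auto simp: algebra_simps)
  done

lemma vec_sum_axis: "(v :: complex^'n) = (\<Sum>j\<in>UNIV. v $ j *s axis j 1)"
  by (simp add: vec_eq_iff axis_def if_distrib cong: if_cong)

lemma norm_smult_axis: "norm (t *s (axis j 1 :: complex^'n)) = norm t"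
proof -
  have "(norm ((t *s (axis j 1 :: complex^'n)) $ i))\<^sup>2 = (if i = j then (norm t)\<^sup>2 else 0)" for i
    by (simp add: axis_def)
  thus ?thesis by (simp add: norm_vec_def L2_set_def)
qed

lemma bounded_linear_smult_axis: "bounded_linear (\<lambda>t::complex. t *s (axis j 1 :: complex^'n))"
  by (rule bounded_linear_intro[where K=1])
     (auto simp: norm_smult_axis, auto simp: vec_eq_iff algebra_simps)

lemma cdiff_line:
  fixes f :: "complex^'n \<Rightarrow> complex"
  assumes L: "(f has_derivative L) (at (z + t *s axis j 1))" "\<And>c v. L (c *s v) = c * L v"
  shows "((\<lambda>t. f (z + t *s axis j 1)) has_field_derivative L (axis j 1)) (at t)"
proof -
  have "((\<lambda>t. z + t *s axis j 1) has_derivative (\<lambda>t. t *s axis j 1)) (at t)"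
    using has_derivative_add[OF has_derivative_const[of z]
        bounded_linear_imp_has_derivative[OF bounded_linear_smult_axis[of j]]] by fastforce
  from has_derivative_compose[OF this L(1)]
  show ?thesis
    by (simp only: has_field_derivative_def L(2) mult_commute_abs)
qed

lemma cdiff_L_eq:
  fixes f :: "complex^'n \<Rightarrow> complex"
  assumes L: "(f has_derivative L) (at z)" "\<And>c v. L (c *s v) = c * L v"
  shows "L v = (\<Sum>j\<in>UNIV. v $ j * cpartial j f z)"
proof -
  interpret bounded_linear L using L(1) by (rule has_derivative_bounded_linear)
  have "cpartial j f z = L (axis j 1)" for j
    unfolding cpartial_def using cdiff_line[of f L z 0 j] L by (intro DERIV_imp_deriv) auto
  moreover have "L v = (\<Sum>j\<in>UNIV. v $ j * L (axis j 1))"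
    by (subst vec_sum_axis[of v]) (simp add: sum L(2))
  ultimately show ?thesis by simp
qed

lemma cpartial_integral:
  fixes f :: "complex^'n \<Rightarrow> complex"
  assumes f: "\<And>w. w \<in> ball a (2*r) \<Longrightarrow> cdiff_at f w" and r: "r > 0" and z: "z \<in> ball a r"
  defines "u \<equiv> \<lambda>t::real. of_real (r/2) * exp (2 * of_real pi * \<i> * of_real t) :: complex"
  shows "cpartial j f z = integral (cbox 0 1) (\<lambda>t. f (z + u t *s axis j 1) / u t)"
proof -
  define h where "h = (\<lambda>t. f (z + t *s axis j 1))"
  have hd: "\<exists>D. (h has_field_derivative D) (at t)" if "norm t < r" for t
  proof -
    have "dist a (z + t *s axis j 1) \<le> dist a z + norm (t *s (axis j 1 :: complex^'n))"
      by (metis add.commute add_diff_cancel_left' dist_commute dist_norm dist_triangle)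
    hence "z + t *s axis j 1 \<in> ball a (2*r)"
      using z that by (simp add: norm_smult_axis)
    then obtain L where "(f has_derivative L) (at (z + t *s axis j 1))" "\<forall>c v. L (c *s v) = c * L v"
      using f unfolding cdiff_at_def by blast
    thus ?thesis unfolding h_def using cdiff_line by blast
  qed
  have hol: "h holomorphic_on ball 0 r"
    by (auto simp: holomorphic_on_open hd)
  have "continuous_on (cball 0 (r/2)) h"
    using r by (intro holomorphic_on_imp_continuous_on[OF holomorphic_on_subset[OF hol]]) auto
  moreover have "h holomorphic_on ball 0 (r/2)"
    using r by (intro holomorphic_on_subset[OF hol]) auto
  ultimately have "(h has_field_derivative (1 / (2 * of_real pi * \<i>) *
      contour_integral(circlepath 0 (r/2)) (\<lambda>u. h u / (u-0)^2))) (at 0)"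
    using r by (intro Cauchy_derivative_integral_circlepath) auto
  hence "cpartial j f z = 1 / (2 * of_real pi * \<i>) *
      contour_integral(circlepath 0 (r/2)) (\<lambda>u. h u / u^2)"
    unfolding cpartial_def h_def[symmetric] by (auto dest: DERIV_imp_deriv)
  also have "contour_integral(circlepath 0 (r/2)) (\<lambda>u. h u / u^2) =
     integral (cbox 0 1) (\<lambda>t. (2 * of_real pi * \<i>) * (h (u t) / u t))"
    unfolding contour_integral_integral interval_cbox[symmetric]
  proof (rule integral_cong)
    fix t :: real assume "t \<in> {0..1}"
    have u0: "u t \<noteq> 0" using r by (simp add: u_def)
    have c: "circlepath 0 (r/2) t = u t" by (simp add: circlepath u_def)
    have "vector_derivative (circlepath 0 (r/2)) (at t) = 2 * of_real pi * \<i> * u t"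
      by (simp add: vector_derivative_circlepath u_def algebra_simps)
    thus "h (circlepath 0 (r/2) t) / (circlepath 0 (r/2) t)\<^sup>2 *
         vector_derivative (circlepath 0 (r/2)) (at t) =
         2 * complex_of_real pi * \<i> * (h (u t) / u t)"
      using u0 by (simp add: c power2_eq_square field_simps)
  qed
  also have "1 / (2 * of_real pi * \<i>) * \<dots> = integral (cbox 0 1) (\<lambda>t. h (u t) / u t)"
    by (subst integral_mult_right) simp
  finally show ?thesis by (simp add: h_def)
qed

text \<open>Differentiation of Cauchy's formula under the integral sign.\<close>

lemma cdiff_at_cpartial:
  fixes f :: "complex^'n \<Rightarrow> complex"
  assumes "\<forall>\<^sub>F w in nhds a. cdiff_at f w"
  shows "cdiff_at (cpartial j f) a"
proof -
  obtain e where e: "e > 0" "\<And>w. w \<in> ball a e \<Longrightarrow> cdiff_at f w"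
    using assms by (auto simp: eventually_nhds_metric dist_commute)
  have add_mem: "z + w \<in> ball a (s + s')" if "z \<in> ball a s" "norm w < s'" for z w :: "complex^'n" and s s'
  proof -
    have "dist a (z + w) \<le> dist a z + norm w"
      by (metis add.commute add_diff_cancel_left' dist_commute dist_norm dist_triangle)
    thus ?thesis using that by simp
  qed
  define r where "r = e / 4"
  have r: "r > 0" using e by (simp add: r_def)
  have er: "cdiff_at f w" if "w \<in> ball a (2*r)" for w
    using e(2)[of w] that r by (simp add: r_def)
  have e2r: "cdiff_at f w" if "w \<in> ball a (2*(2*r))" for w
    using e(2)[of w] that r by (simp add: r_def)
  define u where "u = (\<lambda>t::real. of_real (r/2) * exp (2 * of_real pi * \<i> * of_real t) :: complex)"
  have u0: "u t \<noteq> 0" for t using r by (simp add: u_def)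
  have nu: "norm (u t) = r/2" for t using r by (simp add: u_def norm_mult)
  have ucont: "continuous_on S u" for S unfolding u_def by (intro continuous_intros)
  have axc: "continuous_on S (\<lambda>x. g x *s (axis k 1::complex^'n))" if "continuous_on S g"
    for S and g :: "'x::topological_space \<Rightarrow> complex" and k
    using bounded_linear.continuous_on[OF bounded_linear_smult_axis that] .
  have fcont: "continuous_on (ball a e) f"
    by (intro continuous_at_imp_continuous_on ballI)
       (use e(2) in \<open>auto simp: cdiff_at_def dest: has_derivative_continuous\<close>)
  define v where "v = (\<lambda>t::real. of_real r * exp (2 * of_real pi * \<i> * of_real t) :: complex)"
  have v0: "v t \<noteq> 0" for t using r by (simp add: v_def)
  have nv: "norm (v t) = r" for t using r by (simp add: v_def norm_mult)
  have vcont: "continuous_on S v" for S unfolding v_def by (intro continuous_intros)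
  have P2: "cpartial k f z = integral (cbox 0 1) (\<lambda>t. f (z + v t *s axis k 1) / v t)"
    if "z \<in> ball a (2*r)" for z k
    using cpartial_integral[of a "2*r" f z k, OF e2r] e r that unfolding v_def by simp
  have pcont: "continuous_on (ball a (2*r)) (cpartial k f)" for k
  proof -
    have "continuous_on (ball a (2*r)) (\<lambda>z. integral (cbox 0 1) (\<lambda>t. f (z + v t *s axis k 1) / v t))"
    proof (rule integral_continuous_on_param)
      have "z + v t *s axis k 1 \<in> ball a e" if "z \<in> ball a (2*r)" for z t
        using add_mem[OF that, of "v t *s axis k 1" "2*r"] r by (simp add: norm_smult_axis nv r_def)
      thus "continuous_on (ball a (2*r) \<times> cbox 0 1) (\<lambda>(z, t). f (z + v t *s axis k 1) / v t)"
        unfolding case_prod_unfold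
        by (intro continuous_intros continuous_on_compose2[OF fcont] axc
              continuous_on_compose2[OF vcont]) (auto simp: v0)
    qed
    thus ?thesis by (subst continuous_on_cong[OF refl P2])
  qed
  define F where "F = (\<lambda>z. Blinfun (\<lambda>w::complex^'n. \<Sum>k\<in>UNIV. w $ k * cpartial k f z))"
  have bl: "bounded_linear (\<lambda>w::complex^'n. \<Sum>k\<in>UNIV. w $ k * c k)" for c :: "'n \<Rightarrow> complex"
    by (intro bounded_linear_sum bounded_linear_mult_const bounded_linear_vec_nth)
  have F: "blinfun_apply (F z) w = (\<Sum>k\<in>UNIV. w $ k * cpartial k f z)" for z w
    unfolding F_def by (simp add: bounded_linear_Blinfun_apply bl)
  have Fcont: "continuous_on (ball a (2*r)) F"
    by (rule continuous_on_blinfun_componentwise) (auto simp: F intro!: continuous_intros pcont)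
  have Fder: "(f has_derivative blinfun_apply (F z)) (at z)" if z: "z \<in> ball a e" for z
  proof -
    obtain L where L: "(f has_derivative L) (at z)" "\<And>c v. L (c *s v) = c * L v"
      using e(2)[OF z] unfolding cdiff_at_def by blast
    moreover have "L = blinfun_apply (F z)"
      using cdiff_L_eq[OF L] by (auto simp: F)
    ultimately show ?thesis by simp
  qed
  have mem: "z + u t *s axis j 1 \<in> ball a (2*r)" if "z \<in> ball a r" for z t
    using add_mem[OF that, of "u t *s axis j 1" r] r by (simp add: norm_smult_axis nu)
  have sub: "ball a (2*r) \<subseteq> ball a e" using r by (auto simp: r_def)
  define G where "G = (\<lambda>z t. blinfun_mult_right (inverse (u t)) o\<^sub>L F (z + u t *s axis j 1))"
  have Gapp: "blinfun_apply (G z t) w = inverse (u t) * blinfun_apply (F (z + u t *s axis j 1)) w" for z t w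
    by (simp add: G_def)
  have "((\<lambda>z. integral (cbox 0 1) (\<lambda>t. f (z + u t *s axis j 1) / u t)) has_derivative
      blinfun_apply (integral (cbox 0 1) (G a))) (at a within ball a r)"
  proof (rule leibniz_rule)
    fix z t assume z: "z \<in> ball a r"
    have "((\<lambda>z. z + u t *s axis j 1) has_derivative (\<lambda>h. h)) (at z within ball a r)"
      by (auto intro!: derivative_eq_intros)
    moreover have "z + u t *s axis j 1 \<in> ball a e" using mem[OF z, of t] sub by blast
    ultimately have "((\<lambda>z. f (z + u t *s axis j 1)) has_derivative blinfun_apply (F (z + u t *s axis j 1))) (at z within ball a r)"
      using has_derivative_compose[OF _ Fder] by blast
    thus "((\<lambda>z. f (z + u t *s axis j 1) / u t) has_derivative blinfun_apply (G z t)) (at z within ball a r)"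
      unfolding Gapp divide_inverse
      by (auto intro!: derivative_eq_intros simp: mult.commute)
  next
    fix z assume z: "z \<in> ball a r"
    have "continuous_on (cbox 0 1) (\<lambda>t. f (z + u t *s axis j 1) / u t)"
      using mem[OF z] sub
      by (intro continuous_intros continuous_on_compose2[OF fcont] axc ucont) (auto simp: u0)
    thus "(\<lambda>t. f (z + u t *s axis j 1) / u t) integrable_on cbox 0 1"
      by (rule integrable_continuous)
  next
    show "continuous_on (ball a r \<times> cbox 0 1) (\<lambda>(z, t). G z t)"
      unfolding case_prod_unfold G_def using mem
      by (intro continuous_intros continuous_on_compose2[OF Fcont] axc
            continuous_on_compose2[OF ucont]) (auto simp: u0)
  qed (use r in auto)
  hence D: "((\<lambda>z. integral (cbox 0 1) (\<lambda>t. f (z + u t *s axis j 1) / u t)) has_derivative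
      blinfun_apply (integral (cbox 0 1) (G a))) (at a)"
    using r by (simp add: at_within_open[of _ "ball a r"])
  have "(cpartial j f has_derivative blinfun_apply (integral (cbox 0 1) (G a))) (at a)"
  proof (rule has_derivative_transform_within_open[OF D, of "ball a r"])
    show "integral (cbox 0 1) (\<lambda>t. f (z + u t *s axis j 1) / u t) = cpartial j f z" if "z \<in> ball a r" for z
      using cpartial_integral[of a r f z j, OF er] r sub that unfolding u_def by auto
  qed (use r in auto)
  moreover have "blinfun_apply (integral (cbox 0 1) (G a)) (c *s w) =
      c * blinfun_apply (integral (cbox 0 1) (G a)) w" for c w
  proof -
    have "continuous_on (cbox 0 1) (G a)"
      unfolding G_def using mem[of a] r
      by (intro continuous_intros continuous_on_compose2[OF Fcont] axc ucont) (auto simp: u0)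
    hence "G a integrable_on cbox 0 1" by (rule integrable_continuous)
    hence "blinfun_apply (integral (cbox 0 1) (G a)) w = integral (cbox 0 1) (\<lambda>t. blinfun_apply (G a t) w)" for w
      by (rule blinfun_apply_integral)
    moreover have "blinfun_apply (G a t) (c *s w) = c * blinfun_apply (G a t) w" for t
      by (simp add: Gapp F sum_distrib_left algebra_simps)
    ultimately show ?thesis by simp
  qed
  ultimately show ?thesis unfolding cdiff_at_def by blast
qed


section \<open>The local ring of germs of holomorphic functions\<close>

definition hol_near0 :: "(complex^'n \<Rightarrow> complex) \<Rightarrow> bool" where
  "hol_near0 f \<longleftrightarrow> (\<forall>\<^sub>F z in nhds 0. cdiff_at f z)"

lemma hol_near0_intros:
  "hol_near0 (\<lambda>_. c)"
  "hol_near0 f \<Longrightarrow> hol_near0 g \<Longrightarrow> hol_near0 (\<lambda>z. f z + g z)"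
  "hol_near0 f \<Longrightarrow> hol_near0 g \<Longrightarrow> hol_near0 (\<lambda>z. f z - g z)"
  "hol_near0 f \<Longrightarrow> hol_near0 g \<Longrightarrow> hol_near0 (\<lambda>z. f z * g z)"
  "hol_near0 f \<Longrightarrow> hol_near0 (\<lambda>z. - f z)"
  unfolding hol_near0_def
  by (auto intro: always_eventually[OF allI[OF cdiff_at_const]] elim: eventually_mono eventually_elim2
      intro: cdiff_at_add cdiff_at_diff cdiff_at_mult cdiff_at_uminus)

lemma hol_near0_cpartial: "hol_near0 f \<Longrightarrow> hol_near0 (cpartial j f)"
  unfolding hol_near0_def
  by (subst (asm) eventually_eventually[symmetric]) (erule eventually_mono, rule cdiff_at_cpartial)

definition germ_rel :: "(complex^'n \<Rightarrow> complex) \<Rightarrow> (complex^'n \<Rightarrow> complex) \<Rightarrow> bool" where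
  "germ_rel f g \<longleftrightarrow> hol_near0 f \<and> hol_near0 g \<and> (\<forall>\<^sub>F z in nhds 0. f z = g z)"

text \<open>
  The type \<open>'n hgerm\<close> is the ring of germs at the origin of holomorphic functions on
  \<open>complex^'n\<close>.  A system of local coordinates centred at a point \<open>p\<close> of an \<open>n\<close>-dimensional
  manifold, \<open>n = CARD('n)\<close>, identifies the local ring at \<open>p\<close> with it.
\<close>

quotient_type 'n hgerm = "complex^'n::finite \<Rightarrow> complex" / partial: germ_rel
proof (rule part_equivpI)
  show "\<exists>f :: complex^'n \<Rightarrow> complex. germ_rel f f"
    by (intro exI[of _ "\<lambda>_. 0"]) (auto simp: germ_rel_def intro: hol_near0_intros)
  show "symp (germ_rel :: (complex^'n \<Rightarrow> complex) \<Rightarrow> _)"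
    by (auto simp: symp_def germ_rel_def eq_commute)
  show "transp (germ_rel :: (complex^'n \<Rightarrow> complex) \<Rightarrow> _)"
    by (auto simp: transp_def germ_rel_def elim: eventually_elim2)
qed

instantiation hgerm :: (finite) comm_ring_1
begin

lift_definition zero_hgerm :: "'a hgerm" is "\<lambda>_. 0"
  by (auto simp: germ_rel_def intro: hol_near0_intros)

lift_definition one_hgerm :: "'a hgerm" is "\<lambda>_. 1"
  by (auto simp: germ_rel_def intro: hol_near0_intros)

lift_definition plus_hgerm :: "'a hgerm \<Rightarrow> 'a hgerm \<Rightarrow> 'a hgerm" is "\<lambda>f g z. f z + g z"
  unfolding germ_rel_def by (auto intro: hol_near0_intros elim: eventually_elim2)

lift_definition minus_hgerm :: "'a hgerm \<Rightarrow> 'a hgerm \<Rightarrow> 'a hgerm" is "\<lambda>f g z. f z - g z"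
  unfolding germ_rel_def by (auto intro: hol_near0_intros elim: eventually_elim2)

lift_definition uminus_hgerm :: "'a hgerm \<Rightarrow> 'a hgerm" is "\<lambda>f z. - f z"
  unfolding germ_rel_def by (auto intro: hol_near0_intros elim: eventually_mono)

lift_definition times_hgerm :: "'a hgerm \<Rightarrow> 'a hgerm \<Rightarrow> 'a hgerm" is "\<lambda>f g z. f z * g z"
  unfolding germ_rel_def by (auto intro: hol_near0_intros elim: eventually_elim2)

instance
proof
  show "(0 :: 'a hgerm) \<noteq> 1"
    by transfer (auto simp: germ_rel_def dest: eventually_nhds_x_imp_x)
qed (transfer, (auto simp: germ_rel_def algebra_simps intro!: hol_near0_intros)[1])+

end

lift_definition pderiv_germ :: "'n::finite \<Rightarrow> 'n hgerm \<Rightarrow> 'n hgerm" is cpartial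
proof -
  fix j :: 'n and f g :: "complex^'n \<Rightarrow> complex"
  have eq: "cpartial j f z = cpartial j g z" if "\<forall>\<^sub>F w in nhds z. f w = g w" for z
  proof -
    have "isCont (\<lambda>t. z + t *s axis j 1) (0::complex)"
      by (intro continuous_intros linear_continuous_at bounded_linear_smult_axis)
    hence "filterlim (\<lambda>t. z + t *s axis j 1) (nhds z) (nhds (0::complex))"
      unfolding isCont_def
      using tendsto_at_iff_tendsto_nhds[of "\<lambda>t. z + t *s axis j 1" "0::complex"] by simp
    from eventually_compose_filterlim[OF that this]
    show ?thesis unfolding cpartial_def by (intro deriv_cong_ev) auto
  qed
  assume fg: "germ_rel f g"
  hence "\<forall>\<^sub>F z in nhds 0. \<forall>\<^sub>F w in nhds z. f w = g w"
    by (simp add: germ_rel_def eventually_eventually)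
  hence "\<forall>\<^sub>F z in nhds 0. cpartial j f z = cpartial j g z"
    by (rule eventually_mono) (rule eq)
  thus "germ_rel (cpartial j f) (cpartial j g)"
    using fg by (simp add: germ_rel_def hol_near0_cpartial)
qed

section \<open>Ideals, height, Rees algebras\<close>

lemma module_times: "module ((*) :: 'a::comm_ring_1 \<Rightarrow> 'a \<Rightarrow> 'a)"
  by unfold_locales (simp_all add: algebra_simps)

abbreviation ideal_of :: "'a::comm_ring_1 set \<Rightarrow> 'a set" where
  "ideal_of \<equiv> module.span (*)"

abbreviation is_ideal :: "'a::comm_ring_1 set \<Rightarrow> bool" where
  "is_ideal \<equiv> module.subspace (*)"

definition prime_ideal :: "'a::comm_ring_1 set \<Rightarrow> bool" where
  "prime_ideal P \<longleftrightarrow>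
     is_ideal P \<and> 1 \<notin> P \<and> (\<forall>a b. a * b \<in> P \<longrightarrow> a \<in> P \<or> b \<in> P)"

definition prime_height :: "'a::comm_ring_1 set \<Rightarrow> enat" where
  "prime_height P =
     Sup {enat k | k. \<exists>C :: nat \<Rightarrow> 'a set.
       (\<forall>i\<le>k. prime_ideal (C i)) \<and> (\<forall>i<k. C i \<subset> C (Suc i)) \<and> C k = P}"

definition height :: "'a::comm_ring_1 set \<Rightarrow> enat" where
  "height I = Inf {prime_height P | P. prime_ideal P \<and> I \<subseteq> P}"

fun ideal_power :: "'a::comm_ring_1 set \<Rightarrow> nat \<Rightarrow> 'a set" where
  "ideal_power I 0 = UNIV"
| "ideal_power I (Suc k) = ideal_of {a * b | a b. a \<in> I \<and> b \<in> ideal_power I k}"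

definition rees_algebra :: "'a::comm_ring_1 set \<Rightarrow> 'a poly set" where
  "rees_algebra I = {p. \<forall>i. Polynomial.coeff p i \<in> ideal_power I i}"

section \<open>The polynomial ring in the symbols and \<open>s\<close>\<close>

datatype 'n symvar = Xi 'n | Ess

text \<open>Polynomials over the germs in the variables \<open>Xi j\<close> and \<open>Ess\<close>, the variable \<open>s\<close>.\<close>

type_synonym 'n symbol_poly = "('n symvar \<Rightarrow>\<^sub>0 nat) \<Rightarrow>\<^sub>0 'n hgerm"

definition spvar :: "'n symvar \<Rightarrow> 'n::finite symbol_poly" where
  "spvar v = Poly_Mapping.single (Poly_Mapping.single v 1) 1"

definition spconst :: "'n hgerm \<Rightarrow> 'n::finite symbol_poly" where
  "spconst c = Poly_Mapping.single 0 c"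

definition homogeneous :: "nat \<Rightarrow> 'n::finite symbol_poly \<Rightarrow> bool" where
  "homogeneous d P \<longleftrightarrow>
     (\<forall>m\<in>Poly_Mapping.keys P. (\<Sum>v\<in>Poly_Mapping.keys m. Poly_Mapping.lookup m v) = d)"

section \<open>Linear Jacobian type\<close>

definition jacobian_ideal :: "'n hgerm \<Rightarrow> 'n::finite hgerm set" where
  "jacobian_ideal f = ideal_of (insert f (range (\<lambda>j. pderiv_germ j f)))"

fun rees_gen :: "'n hgerm \<Rightarrow> 'n::finite symvar \<Rightarrow> 'n hgerm poly" where
  "rees_gen f (Xi j) = Polynomial.monom (pderiv_germ j f) 1"
| "rees_gen f Ess = Polynomial.monom f 1"

text \<open>
  \<open>rees_map f\<close> substitutes \<open>rees_gen f v\<close> for the variable \<open>v\<close>; the grading variable of the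
  Rees algebra is that of \<open>poly\<close>.  The map takes values in the Rees algebra of the Jacobian
  ideal, see \<open>rees_map_in_rees_algebra\<close>, so its kernel can be taken in the ambient polynomial ring.
\<close>

definition rees_map :: "'n hgerm \<Rightarrow> 'n::finite symbol_poly \<Rightarrow> 'n hgerm poly" where
  "rees_map f P = (\<Sum>m\<in>Poly_Mapping.keys P. Polynomial.smult (Poly_Mapping.lookup P m)
     (\<Prod>v\<in>Poly_Mapping.keys m. rees_gen f v ^ Poly_Mapping.lookup m v))"

lemma rees_map_in_rees_algebra:
  fixes f :: "'n::finite hgerm"
  shows "rees_map f P \<in> rees_algebra (jacobian_ideal f)"
proof -
  interpret R: module "(*) :: 'n hgerm \<Rightarrow> 'n hgerm \<Rightarrow> 'n hgerm" by (rule module_times)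
  let ?J = "jacobian_ideal f"
  have sub: "R.subspace (ideal_power ?J i)" for i
    by (cases i) (auto simp: R.subspace_UNIV)
  define c where "c = (\<lambda>v. case v of Xi j \<Rightarrow> pderiv_germ j f | Ess \<Rightarrow> f)"
  have gen: "rees_gen f v = Polynomial.monom (c v) 1" for v
    by (cases v) (auto simp: c_def)
  have cJ: "c v \<in> ?J" for v
    by (auto simp: c_def jacobian_ideal_def split: symvar.split intro!: R.span_base)
  have pow: "c v ^ k * b \<in> ideal_power ?J (k + l)" if "b \<in> ideal_power ?J l" for v k b l
  proof (induction k)
    case (Suc k)
    have "c v * (c v ^ k * b) \<in> ideal_power ?J (Suc (k + l))"
      unfolding ideal_power.simps using Suc cJ[of v] by (intro R.span_base) blast
    thus ?case by (simp only: power_Suc mult.assoc add_Suc)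
  qed (use that in simp)
  have mon: "(\<Prod>v\<in>A. rees_gen f v ^ e v) = Polynomial.monom (\<Prod>v\<in>A. c v ^ e v) (\<Sum>v\<in>A. e v)
     \<and> (\<Prod>v\<in>A. c v ^ e v) \<in> ideal_power ?J (\<Sum>v\<in>A. e v)" if "finite A" for A e
    using that
  proof induction
    case (insert v A)
    let ?b = "\<Prod>v\<in>A. c v ^ e v" and ?d = "\<Sum>v\<in>A. e v"
    have "c v ^ e v * ?b \<in> ideal_power ?J (e v + ?d)" using insert.IH by (intro pow) blast
    moreover have "rees_gen f v ^ e v * Polynomial.monom ?b ?d = Polynomial.monom (c v ^ e v * ?b) (e v + ?d)"
      by (simp only: gen monom_power mult_monom mult_1)
    ultimately show ?case
      using insert by (simp only: prod.insert sum.insert if_False not_False_eq_True)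
  qed (simp add: monom_0 one_pCons)
  have "Polynomial.coeff (rees_map f P) i \<in> ideal_power ?J i" for i
  proof -
    have "Polynomial.coeff (rees_map f P) i = (\<Sum>m\<in>Poly_Mapping.keys P. Poly_Mapping.lookup P m *
       Polynomial.coeff (\<Prod>v\<in>Poly_Mapping.keys m. rees_gen f v ^ Poly_Mapping.lookup m v) i)"
      by (simp add: rees_map_def Polynomial.coeff_sum)
    also have "\<dots> \<in> ideal_power ?J i"
    proof (intro R.subspace_sum[OF sub] R.subspace_scale[OF sub])
      fix m :: "'n symvar \<Rightarrow>\<^sub>0 nat"
      show "Polynomial.coeff (\<Prod>v\<in>Poly_Mapping.keys m. rees_gen f v ^ Poly_Mapping.lookup m v) i
              \<in> ideal_power ?J i"
        using mon[of "Poly_Mapping.keys m" "Poly_Mapping.lookup m"] R.subspace_0[OF sub]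
        by (auto simp: coeff_monom)
    qed
    finally show ?thesis .
  qed
  thus ?thesis by (simp add: rees_algebra_def)
qed

definition rees_ker :: "'n hgerm \<Rightarrow> 'n::finite symbol_poly set" where
  "rees_ker f = {P. rees_map f P = 0}"

definition rees_ker1 :: "'n hgerm \<Rightarrow> 'n::finite symbol_poly set" where
  "rees_ker1 f = ideal_of {P \<in> rees_ker f. homogeneous 1 P}"

section \<open>Logarithmic vector fields\<close>

text \<open>A germ of a vector field is given by its coefficient vector with respect to the
  coordinate fields.\<close>

definition vf_apply :: "'n hgerm ^ 'n \<Rightarrow> 'n hgerm \<Rightarrow> 'n::finite hgerm" where
  "vf_apply \<delta> f = (\<Sum>j\<in>UNIV. \<delta> $ j * pderiv_germ j f)"

definition log_derivations :: "'n hgerm \<Rightarrow> ('n::finite hgerm ^ 'n) set" where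
  "log_derivations f = {\<delta>. vf_apply \<delta> f \<in> ideal_of {f}}"

definition principal_symbol :: "'n hgerm ^ 'n \<Rightarrow> 'n::finite symbol_poly" where
  "principal_symbol \<delta> = (\<Sum>j\<in>UNIV. spconst (\<delta> $ j) * spvar (Xi j))"

definition saito_ideal :: "'n hgerm \<Rightarrow> ('n hgerm ^ 'n) set \<Rightarrow> 'n::finite symbol_poly set" where
  "saito_ideal f S = ideal_of (insert (spconst f)
     {principal_symbol \<delta> - spconst \<alpha> * spvar Ess | \<delta> \<alpha>. \<delta> \<in> S \<and> vf_apply \<delta> f = \<alpha> * f})"

section \<open>Complex manifolds and divisors\<close>

definition chart :: "'a topology \<Rightarrow> 'a set \<times> ('a \<Rightarrow> complex^'n) \<Rightarrow> bool" where
  "chart X c \<longleftrightarrow> (case c of (U, \<phi>) \<Rightarrow>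
     openin X U \<and> open (\<phi> ` U) \<and>
     homeomorphic_map (subtopology X U) (top_of_set (\<phi> ` U)) \<phi>)"

definition hol_transition ::
    "'a set \<times> ('a \<Rightarrow> complex^'n) \<Rightarrow> 'a set \<times> ('a \<Rightarrow> complex^'n) \<Rightarrow> bool" where
  "hol_transition c d \<longleftrightarrow> (case (c, d) of ((U, \<phi>), (V, \<psi>)) \<Rightarrow>
     \<forall>z\<in>\<phi> ` (U \<inter> V). \<forall>i. cdiff_at (\<lambda>w. \<psi> (inv_into U \<phi> w) $ i) z)"

definition compatible_charts ::
    "'a set \<times> ('a \<Rightarrow> complex^'n) \<Rightarrow> 'a set \<times> ('a \<Rightarrow> complex^'n) \<Rightarrow> bool" where
  "compatible_charts c d \<longleftrightarrow> hol_transition c d \<and> hol_transition d c"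

definition complex_manifold :: "'a topology \<Rightarrow> ('a set \<times> ('a \<Rightarrow> complex^'n)) set \<Rightarrow> bool" where
  "complex_manifold X A \<longleftrightarrow>
     Hausdorff_space X \<and>
     (\<forall>c\<in>A. chart X c) \<and>
     (\<Union>c\<in>A. fst c) = topspace X \<and>
     (\<forall>c\<in>A. \<forall>d\<in>A. compatible_charts c d)"

text \<open>Local coordinates at \<open>p\<close>: a chart of the maximal atlas that is centred at \<open>p\<close>.\<close>

definition local_coordinates ::
    "'a topology \<Rightarrow> ('a set \<times> ('a \<Rightarrow> complex^'n)) set \<Rightarrow> 'a \<Rightarrow>
     'a set \<times> ('a \<Rightarrow> complex^'n) \<Rightarrow> bool" where
  "local_coordinates X A p c \<longleftrightarrow>
     chart X c \<and> (\<forall>d\<in>A. compatible_charts c d) \<and> p \<in> fst c \<and> snd c p = 0"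

text \<open>
  \<open>f\<close>, written in the coordinates \<open>c\<close>, is a reduced local equation of \<open>D\<close>: the zero set of
  \<open>f \<noteq> 0\<close> is the germ of \<open>D\<close>, and the quotient by \<open>f\<close> has no nilpotents.
\<close>

definition reduced_local_equation ::
    "'a set \<Rightarrow> 'a set \<times> ('a \<Rightarrow> complex^'n) \<Rightarrow> 'n::finite hgerm \<Rightarrow> bool" where
  "reduced_local_equation D c f \<longleftrightarrow>
     f \<noteq> 0 \<and>
     (\<forall>\<^sub>F z in nhds 0. z \<in> snd c ` (fst c \<inter> D) \<longleftrightarrow> rep_hgerm f z = 0) \<and>
     (\<forall>h k. h ^ k \<in> ideal_of {f} \<longrightarrow> h \<in> ideal_of {f})"

definition divisor ::
    "'a topology \<Rightarrow> ('a set \<times> ('a \<Rightarrow> complex^'n::finite)) set \<Rightarrow> 'a set \<Rightarrow> bool" where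
  "divisor X A D \<longleftrightarrow>
     closedin X D \<and>
     (\<forall>p\<in>D. \<exists>c f. local_coordinates X A p c \<and> reduced_local_equation D c f)"

text \<open>
  Linear Jacobian type and strong Saito-holonomicity do not depend on the local coordinates, the
  reduced local equation and the generating set; they are required here for all choices.
  Generating sets need not be finite, so that the set of all logarithmic vector fields is one.
\<close>

definition linear_jacobian_type ::
    "'a topology \<Rightarrow> ('a set \<times> ('a \<Rightarrow> complex^'n::finite)) set \<Rightarrow> 'a set \<Rightarrow> bool" where
  "linear_jacobian_type X A D \<longleftrightarrow>
     (\<forall>p\<in>D. \<forall>c f. local_coordinates X A p c \<and> reduced_local_equation D c f \<longrightarrow>
        rees_ker f = rees_ker1 f)"

definition strongly_saito_holonomic_at ::
    "'a topology \<Rightarrow> ('a set \<times> ('a \<Rightarrow> complex^'n::finite)) set \<Rightarrow> 'a set \<Rightarrow> 'a \<Rightarrow> bool" where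
  "strongly_saito_holonomic_at X A D p \<longleftrightarrow>
     (\<forall>c f S. local_coordinates X A p c \<and> reduced_local_equation D c f \<and>
        module.span (*s) S = log_derivations f \<longrightarrow>
        height (saito_ideal f S) = enat (CARD('n) + 1))"

definition strongly_saito_holonomic ::
    "'a topology \<Rightarrow> ('a set \<times> ('a \<Rightarrow> complex^'n::finite)) set \<Rightarrow> 'a set \<Rightarrow> bool" where
  "strongly_saito_holonomic X A D \<longleftrightarrow> (\<forall>p\<in>D. strongly_saito_holonomic_at X A D p)"

end

theory Submission
  imports Defs
begin

text \<open>
  Let \<open>n\<close> be the dimension, \<open>f\<close> a reduced equation at a point of the divisor, \<open>f\<^sub>j\<close> its partial
  derivatives, and \<open>K\<close> the kernel of the map onto the Rees algebra.  In the case of linear Jacobian type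
  the Saito ideal is \<open>(f) + K\<close>, because the linear forms in \<open>K\<close> are the symbols
  \<open>\<sigma>(\<delta>) - \<alpha> s\<close> of logarithmic vector fields (\<open>rees_ker1_subset_saito_ideal\<close>).  The Rees algebra has
  codimension \<open>n\<close> in the polynomial ring in \<open>\<xi>\<^sub>1, ..., \<xi>\<^sub>n, s\<close> over the germs, and \<open>f\<close> is a nonzerodivisor
  on it, so the height should be \<open>n + 1\<close>.  Both inequalities are proved directly.

  Lower bound.  Over the fraction field of the ring of germs, \<open>K\<close> is generated by the \<open>n\<close> linear forms
  \<open>f \<xi>\<^sub>j - f\<^sub>j s\<close>.  Imposing them successively gives a strict chain of primes of length \<open>n\<close> ending in \<open>K\<close>,
  and a prime over \<open>(f) + K\<close> is strictly larger than \<open>K\<close> (\<open>prime_height_over_rees_kernel\<close>).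

  Upper bound.  One prime over \<open>(f) + K\<close> of height at most \<open>n + 1\<close> suffices.  Let \<open>q\<close> be a minimal prime
  over \<open>f\<close> in the ring of germs.  Since \<open>f\<close> is reduced, the localization at \<open>q\<close> is a discrete valuation
  ring with uniformizer \<open>f\<close>, and some \<open>f\<^sub>j\<close> is a unit in it.  The prime is the kernel of
  \<open>\<xi>\<^sub>j \<mapsto> f\<^sub>j t\<close>, \<open>s \<mapsto> 0\<close> over the quotient by \<open>q\<close>.  Its height is bounded by counting transcendence
  degrees along a chain of primes; over a discrete valuation ring the degree does not grow when the
  contraction jumps from \<open>0\<close> to the maximal ideal (\<open>alg_indep_mod_generic\<close>).

  The facts about germs that enter here (being a domain, discreteness of the valuation, smoothness at
  the generic point) all follow from a single one, \<open>germs_differentially_simple\<close>: a proper ideal that is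
  stable under the partial derivatives is zero, because all Taylor coefficients of its members vanish.
\<close>


section \<open>Ideals and minimal primes\<close>

lemma is_ideal_iff:
  "is_ideal I \<longleftrightarrow> 0 \<in> I \<and> (\<forall>x\<in>I. \<forall>y\<in>I. x + y \<in> I) \<and> (\<forall>c. \<forall>x\<in>I. c * x \<in> I)"
  by (auto simp: module.subspace_def[OF module_times])

lemma is_ideal_ideal_of: "is_ideal (ideal_of S)"
  by (rule module.subspace_span[OF module_times])

lemma ideal_of_subset: "is_ideal I \<Longrightarrow> S \<subseteq> I \<Longrightarrow> ideal_of S \<subseteq> I"
  by (rule module.span_minimal[OF module_times])

lemma ideal_of_base: "x \<in> S \<Longrightarrow> x \<in> ideal_of S"
  by (rule module.span_base[OF module_times])

lemma in_ideal_of_singleton_iff: "x \<in> ideal_of {f} \<longleftrightarrow> f dvd x"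
  by (auto simp: module.span_singleton[OF module_times] dvd_def mult.commute)

lemma is_ideal_zero: "is_ideal {0}"
  by (simp add: is_ideal_iff)

context
  fixes I :: "'a::comm_ring_1 set"
  assumes I: "is_ideal I"
begin

lemma ideal_zero: "0 \<in> I"
  and ideal_add: "x \<in> I \<Longrightarrow> y \<in> I \<Longrightarrow> x + y \<in> I"
  and ideal_mult_left: "x \<in> I \<Longrightarrow> c * x \<in> I"
  and ideal_mult_right: "x \<in> I \<Longrightarrow> x * c \<in> I"
  using I by (auto simp: is_ideal_iff mult.commute)

lemma ideal_minus: "x \<in> I \<Longrightarrow> y \<in> I \<Longrightarrow> x - y \<in> I"
  using ideal_add[of x "- 1 * y"] ideal_mult_left[of y "- 1"] by simp

lemma ideal_add_cancel_left: "x \<in> I \<Longrightarrow> x + y \<in> I \<longleftrightarrow> y \<in> I"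
  using ideal_add[of x y] ideal_minus[of "x + y" x] by auto

lemma ideal_sum: "(\<And>i. i \<in> S \<Longrightarrow> g i \<in> I) \<Longrightarrow> sum g S \<in> I"
  by (rule module.subspace_sum[OF module_times I])

end

context
  fixes P :: "'a::comm_ring_1 set"
  assumes P: "prime_ideal P"
begin

lemma prime_is_ideal: "is_ideal P"
  and prime_one_notin: "1 \<notin> P"
  and prime_mult: "a * b \<in> P \<Longrightarrow> a \<in> P \<or> b \<in> P"
  using P by (auto simp: prime_ideal_def)

lemma prime_mult_iff: "a * b \<in> P \<longleftrightarrow> a \<in> P \<or> b \<in> P"
  using prime_mult ideal_mult_left[OF prime_is_ideal] ideal_mult_right[OF prime_is_ideal] by blast

lemma prime_power: "a ^ k \<in> P \<Longrightarrow> a \<in> P"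
  by (induction k) (auto simp: prime_one_notin dest: prime_mult)

lemma prime_prod_notin: "(\<And>i. i \<in> S \<Longrightarrow> g i \<notin> P) \<Longrightarrow> prod g S \<notin> P"
  by (induction S rule: infinite_finite_induct) (auto simp: prime_one_notin prime_mult_iff)

end

text \<open>
  The complement of a multiplicative set that is maximal among those disjoint from \<open>J\<close> is a minimal
  prime over \<open>J\<close>.  The last conclusion is what minimality means after localization: every element of
  the prime becomes nilpotent modulo \<open>J\<close>.
\<close>

lemma minimal_prime_over_ideal:
  fixes J :: "'a::comm_ring_1 set"
  assumes J: "is_ideal J" "1 \<notin> J"
  obtains P where "prime_ideal P" "J \<subseteq> P" "\<And>c. c \<in> P \<Longrightarrow> \<exists>a k. a \<notin> P \<and> a * c ^ k \<in> J"
proof -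
  define \<A> where "\<A> = {S :: 'a set. 1 \<in> S \<and> (\<forall>a\<in>S. \<forall>b\<in>S. a * b \<in> S) \<and> S \<inter> J = {}}"
  have "\<exists>M\<in>\<A>. \<forall>X\<in>\<A>. M \<subseteq> X \<longrightarrow> X = M"
  proof (rule subset_Zorn_nonempty)
    have "{1} \<in> \<A>" using J by (auto simp: \<A>_def)
    thus "\<A> \<noteq> {}" by blast
    fix \<C> assume ne: "\<C> \<noteq> {}" and ch: "subset.chain \<A> \<C>"
    hence C: "\<C> \<subseteq> \<A>" by (auto simp: subset.chain_def)
    have "a * b \<in> \<Union>\<C>" if ab: "a \<in> \<Union>\<C>" "b \<in> \<Union>\<C>" for a b
    proof -
      obtain S T where ST: "S \<in> \<C>" "a \<in> S" "T \<in> \<C>" "b \<in> T" using ab by blast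
      then consider "S \<subseteq> T" | "T \<subseteq> S" using ch unfolding subset_chain_def by meson
      thus ?thesis
      proof cases
        case 1
        hence "a * b \<in> T" using ST C unfolding \<A>_def by blast
        thus ?thesis using ST by blast
      next
        case 2
        hence "a * b \<in> S" using ST C unfolding \<A>_def by blast
        thus ?thesis using ST by blast
      qed
    qed
    moreover have "1 \<in> \<Union>\<C>" using ne C unfolding \<A>_def by blast
    moreover have "\<Union>\<C> \<inter> J = {}" using C unfolding \<A>_def by blast
    ultimately show "\<Union>\<C> \<in> \<A>" by (simp add: \<A>_def)
  qed
  then obtain S where S: "1 \<in> S" "\<And>a b. a \<in> S \<Longrightarrow> b \<in> S \<Longrightarrow> a * b \<in> S" "S \<inter> J = {}"
    and max: "\<And>X. X \<in> \<A> \<Longrightarrow> S \<subseteq> X \<Longrightarrow> X = S"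
    unfolding \<A>_def by (elim bexE) (simp, metis)
  have nil: "\<exists>a\<in>S. \<exists>k. a * c ^ k \<in> J" if c: "c \<notin> S" for c
  proof (rule ccontr)
    assume no: "\<not> (\<exists>a\<in>S. \<exists>k. a * c ^ k \<in> J)"
    define X where "X = {a * c ^ k | a k. a \<in> S}"
    have XI: "a * c ^ k \<in> X" if "a \<in> S" for a k using that by (auto simp: X_def)
    have "x * y \<in> X" if xy: "x \<in> X" "y \<in> X" for x y
    proof -
      obtain a k b l where *: "x = a * c ^ k" "y = b * c ^ l" "a \<in> S" "b \<in> S"
        using xy by (auto simp: X_def)
      hence "x * y = (a * b) * c ^ (k + l)" by (simp add: power_add algebra_simps)
      thus ?thesis using XI S(2) * by metis
    qed
    moreover have "1 \<in> X" using XI[OF S(1), of 0] by simp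
    moreover have "X \<inter> J = {}" using no by (auto simp: X_def)
    ultimately have "X \<in> \<A>" by (simp add: \<A>_def)
    moreover have "S \<subseteq> X" using XI[of _ 0] by auto
    ultimately have "X = S" by (rule max)
    moreover have "c \<in> X" using XI[OF S(1), of 1] by simp
    ultimately show False using c by simp
  qed
  have powS: "a ^ k \<in> S" if "a \<in> S" for a k using that S by (induction k) auto
  have "x + y \<notin> S" if xy: "x \<notin> S" "y \<notin> S" for x y
  proof
    assume "x + y \<in> S"
    obtain a k b l where ab: "a \<in> S" "a * x ^ k \<in> J" "b \<in> S" "b * y ^ l \<in> J"
      using nil[OF xy(1)] nil[OF xy(2)] by blast
    \<comment> \<open>Each term of the binomial expansion is divisible by \<open>x\<^sup>k\<close> or by \<open>y\<^sup>l\<close>.\<close>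
    have "(a * b) * (x + y) ^ (k + l)
        = (\<Sum>i\<le>k + l. (a * b) * (of_nat ((k + l) choose i) * x ^ i * y ^ (k + l - i)))"
      by (simp add: binomial_ring sum_distrib_left)
    also have "\<dots> \<in> J"
    proof (rule ideal_sum[OF J(1)])
      fix i assume "i \<in> {..k + l}"
      show "(a * b) * (of_nat ((k + l) choose i) * x ^ i * y ^ (k + l - i)) \<in> J"
      proof (cases "k \<le> i")
        case True
        then obtain j where "i = k + j" using le_Suc_ex by blast
        hence "(a * b) * (of_nat ((k + l) choose i) * x ^ i * y ^ (k + l - i))
           = (b * of_nat ((k + l) choose i) * x ^ j * y ^ (k + l - i)) * (a * x ^ k)"
          by (simp add: power_add algebra_simps)
        thus ?thesis using ideal_mult_left[OF J(1) ab(2)] by simp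
      next
        case False
        then obtain j where "k + l - i = l + j"
          using le_Suc_ex[of l "k + l - i"] by (metis diff_le_mono2 add_diff_cancel_left' nat_le_linear)
        hence "(a * b) * (of_nat ((k + l) choose i) * x ^ i * y ^ (k + l - i))
           = (a * of_nat ((k + l) choose i) * x ^ i * y ^ j) * (b * y ^ l)"
          by (simp add: power_add algebra_simps)
        thus ?thesis using ideal_mult_left[OF J(1) ab(4)] by simp
      qed
    qed
    finally show False
      using S(3) S(2)[OF S(2)[OF ab(1,3)] powS[OF \<open>x + y \<in> S\<close>]] by blast
  qed
  moreover have "c * x \<notin> S" if x: "x \<notin> S" for c x
  proof
    assume "c * x \<in> S"
    obtain a k where a: "a \<in> S" "a * x ^ k \<in> J" using nil[OF x] by blast
    have "a * (c * x) ^ k = c ^ k * (a * x ^ k)" by (simp only: power_mult_distrib mult_ac)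
    hence "a * (c * x) ^ k \<in> J" using ideal_mult_left[OF J(1) a(2)] by simp
    thus False using S(3) S(2)[OF a(1) powS[OF \<open>c * x \<in> S\<close>]] by blast
  qed
  moreover have "J \<subseteq> - S" using S(3) by blast
  ultimately have "prime_ideal (- S)"
    using S ideal_zero[OF J(1)] by (auto simp: prime_ideal_def is_ideal_iff)
  with \<open>J \<subseteq> - S\<close> nil show ?thesis by (intro that[of "- S"]) blast+
qed


section \<open>Differentially simple rings\<close>

definition derivation :: "('a::comm_ring_1 \<Rightarrow> 'a) \<Rightarrow> bool" where
  "derivation d \<longleftrightarrow> (\<forall>x y. d (x + y) = d x + d y) \<and> (\<forall>x y. d (x * y) = d x * y + x * d y)"

text \<open>
  No proper ideal except zero is stable under \<open>\<Delta>\<close>.  This one property of the ring of germs stands in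
  for the structure theory of the ring: it yields that the ring is a domain, that the order of
  vanishing along a component is finite, and that some derivative of \<open>f\<close> is nonzero at a generic point.
\<close>

definition differentially_simple :: "('a::comm_ring_1 \<Rightarrow> 'a) set \<Rightarrow> bool" where
  "differentially_simple \<Delta> \<longleftrightarrow> (\<forall>d\<in>\<Delta>. derivation d) \<and>
     (\<forall>I. is_ideal I \<and> 1 \<notin> I \<and> (\<forall>d\<in>\<Delta>. \<forall>x\<in>I. d x \<in> I) \<longrightarrow> I = {0})"

lemma derivation_add: "derivation d \<Longrightarrow> d (x + y) = d x + d y"
  and derivation_mult: "derivation d \<Longrightarrow> d (x * y) = d x * y + x * d y"
  by (auto simp: derivation_def)

lemma derivation_zero: "derivation d \<Longrightarrow> d 0 = 0"
  using derivation_add[of d 0 0] by simp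

lemma derivation_power:
  assumes "derivation d"
  shows "d (c ^ Suc k) = of_nat (Suc k) * c ^ k * d c"
proof (induction k)
  case (Suc k)
  have "d (c ^ Suc (Suc k)) = d c * c ^ Suc k + c * d (c ^ Suc k)"
    by (simp add: derivation_mult[OF assms])
  also have "\<dots> = of_nat (Suc (Suc k)) * c ^ Suc k * d c"
    unfolding Suc by (simp add: algebra_simps)
  finally show ?case .
qed (simp)

lemma power_dvd_derivation:
  assumes "derivation d"
  shows "f ^ k dvd d (f ^ Suc k * b)"
proof -
  have "d (f ^ Suc k * b) = f ^ k * (of_nat (Suc k) * d f * b + f * d b)"
    by (subst derivation_mult[OF assms], subst derivation_power[OF assms]) (simp add: algebra_simps)
  thus ?thesis by simp
qed

lemma differentially_simpleD:
  assumes "differentially_simple \<Delta>" "is_ideal I" "1 \<notin> I"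
    and "\<And>d x. d \<in> \<Delta> \<Longrightarrow> x \<in> I \<Longrightarrow> d x \<in> I"
  shows "I = {0}"
  using assms unfolding differentially_simple_def by blast

text \<open>
  In a torsion-free ring a minimal prime is stable under every derivation \<open>d\<close>: if \<open>a c\<^sup>k = 0\<close> with \<open>k\<close> least
  possible for some \<open>a\<close> outside the prime, then applying \<open>d\<close> and multiplying by \<open>a\<close> gives
  \<open>k a\<^sup>2 c\<^sup>k\<^sup>-\<^sup>1 d(c) = 0\<close>, so \<open>d(c)\<close> lies in the prime by
  the choice of \<open>k\<close>.  Hence the minimal prime is zero.
\<close>

lemma differentially_simple_imp_domain:
  fixes \<Delta> :: "('a::comm_ring_1 \<Rightarrow> 'a) set" and a b :: 'a
  assumes \<Delta>: "differentially_simple \<Delta>"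
    and torsion_free: "\<And>k x. of_nat (Suc k) * x = (0::'a) \<Longrightarrow> x = 0"
    and ab: "a * b = 0"
  shows "a = 0 \<or> b = 0"
proof -
  obtain P :: "'a set" where P: "prime_ideal P"
    and nil: "\<And>c. c \<in> P \<Longrightarrow> \<exists>a k. a \<notin> P \<and> a * c ^ k = 0"
    by (rule minimal_prime_over_ideal[of "{0::'a}"]) (auto simp: is_ideal_zero)
  note idl = prime_is_ideal[OF P]
  have "P = {0}"
  proof (rule differentially_simpleD[OF \<Delta> idl prime_one_notin[OF P]])
    fix d c assume d: "d \<in> \<Delta>" and c: "c \<in> P"
    have der: "derivation d" using \<Delta> d by (auto simp: differentially_simple_def)
    define Q where "Q = (\<lambda>k. \<exists>a. a \<notin> P \<and> a * c ^ k = 0)"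
    have "\<exists>k. Q k" using nil[OF c] by (auto simp: Q_def)
    then obtain k where k: "Q k" "\<And>l. l < k \<Longrightarrow> \<not> Q l"
      using exists_least_iff[of Q] by blast
    then obtain a where a: "a \<notin> P" "a * c ^ k = 0" by (auto simp: Q_def)
    then obtain l where l: "k = Suc l" using ideal_zero[OF idl] by (cases k) auto
    have "0 = a * d (a * c ^ k)" using a derivation_zero[OF der] by simp
    also have "\<dots> = d a * (a * c ^ k) + a * a * d (c ^ k)"
      by (simp add: derivation_mult[OF der] algebra_simps)
    also have "\<dots> = of_nat (Suc l) * ((a * a * d c) * c ^ l)"
      unfolding a(2) unfolding l derivation_power[OF der]
      by (simp only: mult_zero_right mult_zero_left add_0 ac_simps)
    finally have "(a * a * d c) * c ^ l = 0" using torsion_free[of l "(a * a * d c) * c ^ l"] by simp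
    moreover have "\<not> Q l" using k(2) l by simp
    ultimately have "a * a * d c \<in> P" by (auto simp: Q_def)
    thus "d c \<in> P" using a by (auto simp: prime_mult_iff[OF P])
  qed
  thus ?thesis using ab prime_mult[OF P, of a b] by auto
qed

text \<open>
  The localization at the generic point \<open>q\<close> of a component of the reduced hypersurface \<open>f = 0\<close> is a
  discrete valuation ring with uniformizer \<open>f\<close>.  A fraction with denominator \<open>a\<close> outside \<open>q\<close> is
  handled by multiplying through by \<open>a\<close>.
\<close>

locale generic_component =
  fixes \<Delta> :: "('a::idom \<Rightarrow> 'a) set" and f :: 'a and q :: "'a set"
  assumes simple: "differentially_simple \<Delta>"
    and q: "prime_ideal q"
    and f_nonzero: "f \<noteq> 0"
    and f_in: "f \<in> q"
    and uniformizer: "\<And>c. c \<in> q \<Longrightarrow> \<exists>a. a \<notin> q \<and> f dvd a * c"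
begin

lemma q_ideal: "is_ideal q" by (rule prime_is_ideal[OF q])

lemma derivations: "d \<in> \<Delta> \<Longrightarrow> derivation d"
  using simple by (auto simp: differentially_simple_def)

text \<open>
  The hypersurface is smooth at \<open>q\<close>: if all derivatives of \<open>f\<close> were in \<open>q\<close>, then \<open>q\<close>, which is locally
  generated by \<open>f\<close>, would be stable.
\<close>

lemma derivative_notin:
  obtains d where "d \<in> \<Delta>" "d f \<notin> q"
proof -
  have "\<exists>d\<in>\<Delta>. d f \<notin> q"
  proof (rule ccontr)
    assume "\<not> (\<exists>d\<in>\<Delta>. d f \<notin> q)"
    hence df: "d f \<in> q" if "d \<in> \<Delta>" for d using that by blast
    have "q = {0}"
    proof (rule differentially_simpleD[OF simple q_ideal prime_one_notin[OF q]])
      fix d c assume d: "d \<in> \<Delta>" and c: "c \<in> q"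
      obtain a b where ab: "a \<notin> q" "a * c = f * b" using uniformizer[OF c] by (auto simp: dvd_def)
      have "d a * c + a * d c = d f * b + f * d b"
        using ab(2) derivation_mult[OF derivations[OF d]] by metis
      moreover have "d f * b + f * d b \<in> q" "d a * c \<in> q"
        using df[OF d] f_in c q_ideal by (auto intro: ideal_add ideal_mult_left ideal_mult_right)
      ultimately have "a * d c \<in> q" using ideal_add_cancel_left[OF q_ideal] by metis
      thus "d c \<in> q" using ab(1) prime_mult[OF q] by blast
    qed
    thus False using f_in f_nonzero by simp
  qed
  thus ?thesis using that by blast
qed

text \<open>
  Krull's intersection theorem for the localization at \<open>q\<close>: the elements of infinite order along \<open>f\<close>
  form a proper ideal, and it is stable because a derivation lowers the order by at most one.
\<close>

lemma finite_order:
  assumes "c \<noteq> 0"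
  obtains k where "\<And>a. a \<notin> q \<Longrightarrow> \<not> f ^ k dvd a * c"
proof -
  define N where "N = {c. \<forall>k. \<exists>a. a \<notin> q \<and> f ^ k dvd a * c}"
  have "N = {0}"
  proof (rule differentially_simpleD[OF simple])
    show "is_ideal N" unfolding is_ideal_iff
    proof (intro conjI ballI allI)
      show "0 \<in> N" using prime_one_notin[OF q] by (auto simp: N_def)
      fix x assume x: "x \<in> N"
      show "c * x \<in> N" for c
        using x unfolding N_def by (simp, metis dvd_mult mult.left_commute)
      fix y assume y: "y \<in> N"
      show "x + y \<in> N" unfolding N_def
      proof (intro CollectI allI)
        fix k
        obtain a where a: "a \<notin> q" "f ^ k dvd a * x" using x unfolding N_def by blast
        obtain b where b: "b \<notin> q" "f ^ k dvd b * y" using y unfolding N_def by blast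
        note ab = a b
        have "(a * b) * (x + y) = b * (a * x) + a * (b * y)" by (simp add: algebra_simps)
        moreover have "f ^ k dvd b * (a * x) + a * (b * y)" using dvd_add[OF dvd_mult[OF ab(2), of b] dvd_mult[OF ab(4), of a]] by simp
        moreover have "a * b \<notin> q" using ab by (simp add: prime_mult_iff[OF q])
        ultimately show "\<exists>a. a \<notin> q \<and> f ^ k dvd a * (x + y)" by metis
      qed
    qed
    show "1 \<notin> N"
    proof
      assume "1 \<in> N"
      hence "\<exists>a. a \<notin> q \<and> f ^ 1 dvd a * 1" unfolding N_def by blast
      then obtain a where "a \<notin> q" "f dvd a" by auto
      thus False using f_in ideal_mult_right[OF q_ideal] by (auto simp: dvd_def)
    qed
    fix d c assume d: "d \<in> \<Delta>" and c: "c \<in> N"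
    show "d c \<in> N" unfolding N_def
    proof (intro CollectI allI)
      fix k
      obtain a b where ab: "a \<notin> q" "a * c = f ^ Suc k * b"
        using c unfolding N_def dvd_def by blast
      have "d (a * c) = d a * c + a * d c" by (rule derivation_mult[OF derivations[OF d]])
      hence "(a * a) * d c = a * d (a * c) - d a * (a * c)" by (simp add: algebra_simps)
      moreover have "f ^ k dvd d (a * c)"
        unfolding ab(2) by (rule power_dvd_derivation[OF derivations[OF d]])
      moreover have "f ^ k dvd a * c" unfolding ab(2) by simp
      ultimately have "f ^ k dvd (a * a) * d c" by (metis dvd_diff dvd_mult)
      moreover have "a * a \<notin> q" using ab by (simp add: prime_mult_iff[OF q])
      ultimately show "\<exists>a. a \<notin> q \<and> f ^ k dvd a * d c" by blast
    qed
  qed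
  hence "c \<notin> N" using assms by blast
  thus ?thesis using that by (auto simp: N_def)
qed

text \<open>
  Division by the content: as long as the whole family is divisible by \<open>f\<close> locally, a power of \<open>f\<close> can
  be split off, and this stops because the orders are finite.
\<close>

lemma primitive_part:
  fixes c :: "'i \<Rightarrow> 'a"
  assumes E: "finite E" "e0 \<in> E" "c e0 \<noteq> 0"
  obtains a k c' where "a \<notin> q" "\<And>e. e \<in> E \<Longrightarrow> a * c e = f ^ k * c' e"
    and "\<exists>e\<in>E. c' e \<notin> q"
proof -
  define Q where "Q = (\<lambda>k. \<exists>a. a \<notin> q \<and> (\<forall>e\<in>E. f ^ k dvd a * c e))"
  obtain l where "\<not> Q l" using finite_order[OF E(3)] E(2) by (metis Q_def)
  moreover have "Q 0" using prime_one_notin[OF q] by (auto simp: Q_def)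
  ultimately obtain k where k: "Q k" "\<not> Q (Suc k)"
    by (induction l) auto
  then obtain a where a: "a \<notin> q" "\<forall>e\<in>E. \<exists>x. a * c e = f ^ k * x" by (auto simp: Q_def dvd_def)
  then obtain c' where c': "\<And>e. e \<in> E \<Longrightarrow> a * c e = f ^ k * c' e" by metis
  have "\<exists>e\<in>E. c' e \<notin> q"
  proof (rule ccontr)
    assume "\<not> (\<exists>e\<in>E. c' e \<notin> q)"
    hence "\<forall>e\<in>E. \<exists>b. b \<notin> q \<and> f dvd b * c' e" using uniformizer by blast
    then obtain b where b: "\<And>e. e \<in> E \<Longrightarrow> b e \<notin> q" "\<And>e. e \<in> E \<Longrightarrow> f dvd b e * c' e" by metis
    have "f ^ Suc k dvd (prod b E * a) * c e" if e: "e \<in> E" for e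
    proof -
      have "(prod b E * a) * c e = prod b E * (f ^ k * c' e)" using c'[OF e] by (simp only: mult.assoc)
      also have "\<dots> = prod b (E - {e}) * (f ^ k * (b e * c' e))"
        by (subst prod.remove[OF E(1) e]) (simp only: mult_ac)
      finally have "(prod b E * a) * c e = prod b (E - {e}) * (f ^ k * (b e * c' e))" .
      moreover have "f ^ k * f dvd f ^ k * (b e * c' e)" using b(2)[OF e] by (intro mult_dvd_mono) auto
      ultimately show ?thesis by (metis dvd_mult power_Suc2)
    qed
    moreover have "prod b E * a \<notin> q"
      using a(1) prime_prod_notin[OF q, of E b] b(1) by (simp add: prime_mult_iff[OF q])
    ultimately have "Q (Suc k)" by (auto simp: Q_def)
    thus False using k(2) by simp
  qed
  with a(1) c' show ?thesis by (rule that)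
qed

text \<open>
  \<open>q\<close> has height one: a nonzero prime below it contains some \<open>f\<^sup>k c'\<close> with \<open>c'\<close> outside \<open>q\<close>, hence \<open>f\<close>.
\<close>

lemma prime_below:
  assumes P: "prime_ideal P" "P \<subseteq> q" "P \<noteq> {0}"
  shows "P = q"
proof -
  note idl = prime_is_ideal[OF P(1)]
  obtain c where c: "c \<in> P" "c \<noteq> 0" using P(3) ideal_zero[OF idl] by blast
  obtain a k c' where a: "a \<notin> q" "a * c = f ^ k * c'" "c' \<notin> q"
    using primitive_part[of "{c}" c "\<lambda>x. x"] c by (metis finite.emptyI finite_insert singletonI singletonD)
  have "f ^ k * c' \<in> P" using ideal_mult_left[OF idl c(1), of a] a(2) by simp
  hence "f ^ k \<in> P" using prime_mult[OF P(1)] a(3) P(2) by blast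
  hence f: "f \<in> P" by (rule prime_power[OF P(1)])
  have "d \<in> P" if d: "d \<in> q" for d
  proof -
    obtain b x where "b \<notin> q" "b * d = f * x" using uniformizer[OF d] by (auto simp: dvd_def)
    thus ?thesis using ideal_mult_right[OF idl f, of x] prime_mult[OF P(1), of b d] P(2) by auto
  qed
  thus ?thesis using P(2) by blast
qed

end

text \<open>
  If \<open>f\<close> is reduced, then modulo \<open>f\<close> the localization at a minimal prime is a reduced local ring with
  only one prime, hence a field; so \<open>f\<close> generates the maximal ideal there.
\<close>

lemma generic_component_exists:
  fixes f :: "'a::idom" and \<Delta> :: "('a \<Rightarrow> 'a) set"
  assumes "differentially_simple \<Delta>" "f \<noteq> 0" "\<not> f dvd 1"
    and reduced: "\<And>h k. f dvd h ^ k \<Longrightarrow> f dvd h"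
  obtains q where "generic_component \<Delta> f q"
proof -
  obtain q where q: "prime_ideal q" "ideal_of {f} \<subseteq> q"
    and nil: "\<And>c. c \<in> q \<Longrightarrow> \<exists>a k. a \<notin> q \<and> a * c ^ k \<in> ideal_of {f}"
    by (rule minimal_prime_over_ideal[OF is_ideal_ideal_of, of "{f}"])
       (use assms in \<open>auto simp: in_ideal_of_singleton_iff\<close>)
  have "\<exists>a. a \<notin> q \<and> f dvd a * c" if c: "c \<in> q" for c
  proof -
    obtain a k where a: "a \<notin> q" "f dvd a * c ^ k"
      using nil[OF c] by (auto simp: in_ideal_of_singleton_iff)
    have "f dvd (a * c) ^ Suc k"
      using dvd_mult[OF a(2), of "a ^ k * c"] by (simp add: power_mult_distrib mult_ac)
    thus ?thesis using reduced a(1) by blast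
  qed
  thus ?thesis using assms q ideal_of_base[of f "{f}"]
    by (intro that[of q]) (unfold_locales, auto)
qed


section \<open>The ring of germs is differentially simple\<close>

lemma germ_rel_refl_iff: "germ_rel F F \<longleftrightarrow> hol_near0 F"
  by (simp add: germ_rel_def)

lemma abs_rep_hgerm [simp]: "abs_hgerm (rep_hgerm g) = g"
  by (rule Quotient3_abs_rep[OF Quotient3_hgerm])

lemma hol_near0_rep_hgerm: "hol_near0 (rep_hgerm g)"
  using Quotient3_rep_reflp[OF Quotient3_hgerm] by (simp add: germ_rel_refl_iff)

lemma abs_hgerm_eq_iff:
  "hol_near0 F \<Longrightarrow> hol_near0 G \<Longrightarrow> abs_hgerm F = abs_hgerm G \<longleftrightarrow> (\<forall>\<^sub>F z in nhds 0. F z = G z)"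
  using Quotient3_rel[OF Quotient3_hgerm, of F G] by (auto simp: germ_rel_def)

lemma abs_hgerm_arith:
  "hol_near0 F \<Longrightarrow> hol_near0 G \<Longrightarrow> abs_hgerm F + abs_hgerm G = abs_hgerm (\<lambda>z. F z + G z)"
  "hol_near0 F \<Longrightarrow> hol_near0 G \<Longrightarrow> abs_hgerm F * abs_hgerm G = abs_hgerm (\<lambda>z. F z * G z)"
  "hol_near0 F \<Longrightarrow> pderiv_germ j (abs_hgerm F) = abs_hgerm (cpartial j F)"
  by (simp_all add: plus_hgerm.abs_eq times_hgerm.abs_eq pderiv_germ.abs_eq germ_rel_refl_iff)

lift_definition germ_value :: "'n::finite hgerm \<Rightarrow> complex" is "\<lambda>F. F 0"
  by (auto simp: germ_rel_def dest: eventually_nhds_x_imp_x)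

lemma germ_value_abs: "hol_near0 F \<Longrightarrow> germ_value (abs_hgerm F) = F 0"
  by (simp add: germ_value.abs_eq germ_rel_refl_iff)

lemma germ_value_simps [simp]:
  "germ_value 0 = 0" "germ_value 1 = 1"
  "germ_value (a + b) = germ_value a + germ_value b"
  "germ_value (a * b) = germ_value a * germ_value b"
  by (transfer, simp)+

lemma germ_value_of_nat [simp]: "germ_value (of_nat k) = of_nat k"
  by (induction k) simp_all

lemma cdiff_at_inverse:
  assumes "cdiff_at F z" "F z \<noteq> 0"
  shows "cdiff_at (\<lambda>w. inverse (F w)) z"
proof -
  obtain L where L: "(F has_derivative L) (at z)" "\<And>c v. L (c *s v) = c * L v"
    using assms(1) by (auto simp: cdiff_at_def)
  have "((\<lambda>w. inverse (F w)) has_derivative (\<lambda>h. - (inverse (F z) * L h * inverse (F z)))) (at z)"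
    using Deriv.has_derivative_inverse[OF assms(2) L(1)] .
  thus ?thesis unfolding cdiff_at_def
    by (intro exI[of _ "\<lambda>h. - (inverse (F z) * L h * inverse (F z))"]) (simp add: L(2))
qed

lemma cdiff_at_imp_isCont: "cdiff_at F z \<Longrightarrow> isCont F z"
  unfolding cdiff_at_def using has_derivative_continuous by blast

lemma germ_dvd_one_iff: "g dvd (1 :: 'n::finite hgerm) \<longleftrightarrow> germ_value g \<noteq> 0"
proof
  assume "g dvd 1"
  then obtain h where "1 = g * h" by (auto simp: dvd_def)
  hence "germ_value g * germ_value h = 1" by (metis germ_value_simps(2,4))
  thus "germ_value g \<noteq> 0" by auto
next
  assume nz: "germ_value g \<noteq> 0"
  define F where "F = rep_hgerm g"
  have F: "hol_near0 F" "abs_hgerm F = g" by (simp_all add: F_def hol_near0_rep_hgerm)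
  hence "F 0 \<noteq> 0" using nz germ_value_abs by metis
  have "isCont F 0"
    using F(1) eventually_nhds_x_imp_x[of "cdiff_at F"] by (intro cdiff_at_imp_isCont) (simp add: hol_near0_def)
  hence "filterlim F (nhds (F 0)) (nhds 0)"
    unfolding isCont_def using tendsto_at_iff_tendsto_nhds[of F 0] by simp
  moreover have "\<forall>\<^sub>F w in nhds (F 0). w \<noteq> 0"
    using \<open>F 0 \<noteq> 0\<close> by (intro eventually_nhds_in_open[of "-{0}", simplified]) auto
  ultimately have ne: "\<forall>\<^sub>F z in nhds 0. F z \<noteq> 0" by (rule eventually_compose_filterlim[rotated])
  define H where "H = (\<lambda>z. inverse (F z))"
  have H: "hol_near0 H"
    using ne F(1) unfolding hol_near0_def H_def by eventually_elim (rule cdiff_at_inverse)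
  have "g * abs_hgerm H = abs_hgerm (\<lambda>z. F z * H z)"
    using abs_hgerm_arith(2)[OF F(1) H] F(2) by simp
  also have "\<dots> = abs_hgerm (\<lambda>_. 1)"
  proof (subst abs_hgerm_eq_iff)
    show "\<forall>\<^sub>F z in nhds 0. F z * H z = 1" using ne by eventually_elim (simp add: H_def)
  qed (use F H in \<open>auto intro: hol_near0_intros\<close>)
  also have "\<dots> = 1" by (simp add: one_hgerm_def)
  finally show "g dvd 1" by (metis dvd_triv_left)
qed

lemma cpartial_DERIV:
  assumes "cdiff_at F z"
  shows "((\<lambda>t. F (z + t *s axis j 1)) has_field_derivative cpartial j F z) (at 0)"
proof -
  obtain L where L: "(F has_derivative L) (at z)" "\<And>c v. L (c *s v) = c * L v"
    using assms by (auto simp: cdiff_at_def)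
  hence "((\<lambda>t. F (z + t *s axis j 1)) has_field_derivative L (axis j 1)) (at 0)"
    by (intro cdiff_line) auto
  thus ?thesis unfolding cpartial_def using DERIV_imp_deriv by metis
qed

lemma cpartial_add:
  assumes "cdiff_at F z" "cdiff_at G z"
  shows "cpartial j (\<lambda>w. F w + G w) z = cpartial j F z + cpartial j G z"
  unfolding cpartial_def[of j "\<lambda>w. F w + G w"]
  by (intro DERIV_imp_deriv DERIV_add cpartial_DERIV assms)

lemma cpartial_mult:
  assumes "cdiff_at F z" "cdiff_at G z"
  shows "cpartial j (\<lambda>w. F w * G w) z = cpartial j F z * G z + F z * cpartial j G z"
proof -
  have "((\<lambda>t. F (z + t *s axis j 1) * G (z + t *s axis j 1)) has_field_derivative
          cpartial j F z * G z + cpartial j G z * F z) (at 0)"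
    using DERIV_mult[OF cpartial_DERIV[OF assms(1), of j] cpartial_DERIV[OF assms(2), of j]] by simp
  thus ?thesis unfolding cpartial_def[of j "\<lambda>w. F w * G w"]
    by (simp add: DERIV_imp_deriv mult.commute)
qed

lemma derivation_pderiv_germ: "derivation (pderiv_germ j)"
  unfolding derivation_def
proof (intro conjI allI)
  fix a b :: "'a hgerm"
  define F G where "F = rep_hgerm a" and "G = rep_hgerm b"
  have F: "hol_near0 F" "a = abs_hgerm F" and G: "hol_near0 G" "b = abs_hgerm G"
    by (simp_all add: F_def G_def hol_near0_rep_hgerm)
  note FG = F(1) G(1)
  have near: "\<forall>\<^sub>F z in nhds 0. cdiff_at F z \<and> cdiff_at G z"
    using FG by (simp add: hol_near0_def eventually_conj_iff)
  have "pderiv_germ j (a + b) = abs_hgerm (cpartial j (\<lambda>z. F z + G z))"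
    unfolding F(2) G(2) by (simp add: abs_hgerm_arith FG hol_near0_intros)
  also have "\<dots> = abs_hgerm (\<lambda>z. cpartial j F z + cpartial j G z)"
  proof (subst abs_hgerm_eq_iff)
    show "\<forall>\<^sub>F z in nhds 0. cpartial j (\<lambda>z. F z + G z) z = cpartial j F z + cpartial j G z"
      using near by eventually_elim (simp add: cpartial_add)
  qed (simp_all add: FG hol_near0_intros hol_near0_cpartial)
  also have "\<dots> = pderiv_germ j a + pderiv_germ j b"
    unfolding F(2) G(2) by (simp add: abs_hgerm_arith FG hol_near0_intros hol_near0_cpartial)
  finally show "pderiv_germ j (a + b) = pderiv_germ j a + pderiv_germ j b" .
  have "pderiv_germ j (a * b) = abs_hgerm (cpartial j (\<lambda>z. F z * G z))"
    unfolding F(2) G(2) by (simp add: abs_hgerm_arith FG hol_near0_intros)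
  also have "\<dots> = abs_hgerm (\<lambda>z. cpartial j F z * G z + F z * cpartial j G z)"
  proof (subst abs_hgerm_eq_iff)
    show "\<forall>\<^sub>F z in nhds 0. cpartial j (\<lambda>z. F z * G z) z = cpartial j F z * G z + F z * cpartial j G z"
      using near by eventually_elim (simp add: cpartial_mult)
  qed (simp_all add: FG hol_near0_intros hol_near0_cpartial)
  also have "\<dots> = pderiv_germ j a * b + a * pderiv_germ j b"
    unfolding F(2) G(2) by (simp add: abs_hgerm_arith FG hol_near0_intros hol_near0_cpartial)
  finally show "pderiv_germ j (a * b) = pderiv_germ j a * b + a * pderiv_germ j b" .
qed

definition directional :: "complex^'n \<Rightarrow> (complex^'n \<Rightarrow> complex) \<Rightarrow> complex^'n \<Rightarrow> complex" where
  "directional v G z = (\<Sum>j\<in>UNIV. v $ j * cpartial j G z)"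

lemma cdiff_at_directional:
  assumes "open S" "\<And>z. z \<in> S \<Longrightarrow> cdiff_at G z" "z \<in> S"
  shows "cdiff_at (directional v G) z"
proof -
  have "cdiff_at (cpartial j G) z" for j
    using eventually_nhds_in_open[OF assms(1,3)]
    by (intro cdiff_at_cpartial) (auto elim: eventually_mono intro: assms(2))
  moreover have "cdiff_at (\<lambda>w. \<Sum>j\<in>T. H j w) z" if "finite T" "\<And>j. cdiff_at (H j) z"
    for T :: "'a set" and H
    using that by (induction T rule: finite_induct) (auto intro: cdiff_at_add cdiff_at_const)
  ultimately have "cdiff_at (\<lambda>w. \<Sum>j\<in>UNIV. v $ j * cpartial j G w) z"
    by (simp add: cdiff_at_mult[OF cdiff_at_const])
  thus ?thesis by (simp add: directional_def[abs_def])
qed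

lemma directional_DERIV:
  assumes "cdiff_at G (t *s v)"
  shows "((\<lambda>t. G (t *s v)) has_field_derivative directional v G (t *s v)) (at t)"
proof -
  obtain L where L: "(G has_derivative L) (at (t *s v))" "\<And>c w. L (c *s w) = c * L w"
    using assms by (auto simp: cdiff_at_def)
  have "bounded_linear (\<lambda>t::complex. t *s v)"
    by (intro linear_conv_bounded_linear[THEN iffD1] linearI) (simp_all add: vec_eq_iff algebra_simps)
  from has_derivative_compose[OF bounded_linear_imp_has_derivative[OF this] L(1)]
  have "((\<lambda>t. G (t *s v)) has_derivative (\<lambda>s. s * L v)) (at t)" by (simp add: L(2))
  moreover have "L v = directional v G (t *s v)"
    unfolding directional_def by (rule cdiff_L_eq[OF L])
  ultimately show ?thesis by (simp add: has_field_derivative_def mult_commute_abs)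
qed

lemma norm_smult_vec: "norm (t *s (v :: complex^'n)) = norm t * norm v"
  by (simp add: norm_vec_def norm_mult L2_set_right_distrib[symmetric])

text \<open>
  On the complex line through the origin and \<open>v\<close>, the iterated directional derivatives along \<open>v\<close> are
  the higher derivatives of a function of one variable, so the one-variable identity theorem applies.
\<close>

lemma zero_on_ball_if_directional_derivatives_vanish:
  fixes F :: "complex^'n \<Rightarrow> complex"
  assumes F: "\<And>z. z \<in> ball 0 r \<Longrightarrow> cdiff_at F z"
    and vanish: "\<And>v k. (directional v ^^ k) F 0 = 0"
    and v: "v \<in> ball 0 r"
  shows "F v = 0"
proof (cases "v = 0")
  case True thus ?thesis using vanish[of 0 v] by simp
next
  case False
  \<comment> \<open>The line meets the ball in the disc of radius \<open>\<rho>\<close>, and \<open>v\<close> is its point with parameter \<open>1\<close>.\<close>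
  define \<rho> where "\<rho> = r / norm v"
  have \<rho>: "\<rho> > 1" using False v by (simp add: \<rho>_def field_simps)
  have mem: "t *s v \<in> ball 0 r" if "t \<in> ball 0 \<rho>" for t
    using that False by (simp add: norm_smult_vec \<rho>_def field_simps)
  define g where "g = (\<lambda>k t. (directional v ^^ k) F (t *s v))"
  have "cdiff_at ((directional v ^^ k) F) z" if "z \<in> ball 0 r" for k z
    using that by (induction k arbitrary: z) (auto intro: F cdiff_at_directional[of "ball 0 r"])
  hence g: "(g k has_field_derivative g (Suc k) t) (at t)" if "t \<in> ball 0 \<rho>" for k t
    unfolding g_def using directional_DERIV[of "(directional v ^^ k) F" t v] mem[OF that] by simp
  have "(deriv ^^ k) (g 0) t = g k t" if "t \<in> ball 0 \<rho>" for k t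
    using that
  proof (induction k arbitrary: t)
    case (Suc k)
    have "\<forall>\<^sub>F x in nhds t. (deriv ^^ k) (g 0) x = g k x"
      using eventually_nhds_in_open[OF open_ball Suc.prems] by eventually_elim (rule Suc.IH)
    hence "deriv ((deriv ^^ k) (g 0)) t = deriv (g k) t" by (intro deriv_cong_ev) auto
    thus ?case using DERIV_imp_deriv[OF g[OF Suc.prems]] by simp
  qed simp
  moreover have "g k 0 = 0" for k using vanish by (simp add: g_def)
  moreover have "g 0 holomorphic_on ball 0 \<rho>"
    unfolding holomorphic_on_open[OF open_ball] using g[of _ 0] by blast
  ultimately have "g 0 1 = 0"
    using \<rho> by (intro holomorphic_fun_eq_0_on_ball[of "g 0" 0 \<rho> 1]) auto
  thus ?thesis by (simp add: g_def)
qed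

text \<open>
  A proper ideal consists of germs that vanish at the origin.  If it is stable under the coordinate
  fields, then all iterated derivatives of its members vanish there as well.
\<close>

theorem germs_differentially_simple:
  "differentially_simple (range (pderiv_germ :: 'n::finite \<Rightarrow> 'n hgerm \<Rightarrow> 'n hgerm))"
  unfolding differentially_simple_def
proof (intro conjI allI impI)
  show "\<forall>d\<in>range (pderiv_germ :: 'n \<Rightarrow> 'n hgerm \<Rightarrow> 'n hgerm). derivation d"
    by (simp add: derivation_pderiv_germ)
next
  fix I :: "'n hgerm set"
  assume asm: "is_ideal I \<and> 1 \<notin> I \<and> (\<forall>d\<in>range pderiv_germ. \<forall>x\<in>I. d x \<in> I)"
  hence I: "is_ideal I" and one: "1 \<notin> I" by simp_all
  have stable: "pderiv_germ j x \<in> I" if "x \<in> I" for j x using that asm by simp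
  have vanish: "germ_value g = 0" if "g \<in> I" for g
  proof (rule ccontr)
    assume "germ_value g \<noteq> 0"
    then obtain h where "1 = g * h" unfolding germ_dvd_one_iff[symmetric] dvd_def by blast
    thus False using one ideal_mult_right[OF I that, of h] by simp
  qed
  have directional: "hol_near0 (directional v G) \<and> abs_hgerm (directional v G) \<in> I"
    if G: "hol_near0 G" "abs_hgerm G \<in> I" for v G
  proof -
    have "hol_near0 (\<lambda>z. \<Sum>j\<in>S. v $ j * cpartial j G z) \<and>
          abs_hgerm (\<lambda>z. \<Sum>j\<in>S. v $ j * cpartial j G z) \<in> I" if "finite S" for S
      using that
    proof (induction S rule: finite_induct)
      case empty
      have "abs_hgerm (\<lambda>_::complex^'n. 0) = 0" by (simp add: zero_hgerm_def)
      thus ?case using ideal_zero[OF I] by (simp add: hol_near0_intros)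
    next
      case (insert j S)
      define H where "H = (\<lambda>z. \<Sum>j\<in>S. v $ j * cpartial j G z)"
      have H: "hol_near0 H" "abs_hgerm H \<in> I" using insert.IH by (simp_all add: H_def)
      have D: "hol_near0 (cpartial j G)" by (rule hol_near0_cpartial[OF G(1)])
      have "abs_hgerm (\<lambda>_. v $ j) * pderiv_germ j (abs_hgerm G) + abs_hgerm H \<in> I"
        by (intro ideal_add[OF I] ideal_mult_left[OF I] stable G H)
      also have "abs_hgerm (\<lambda>_. v $ j) * pderiv_germ j (abs_hgerm G) + abs_hgerm H
          = abs_hgerm (\<lambda>z. v $ j * cpartial j G z + H z)"
        by (simp add: abs_hgerm_arith G D H hol_near0_intros)
      finally show ?case using insert.hyps D H by (simp add: H_def hol_near0_intros)
    qed
    from this[of UNIV] show ?thesis by (simp add: directional_def[abs_def])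
  qed
  have "g = 0" if g: "g \<in> I" for g
  proof -
    define F where "F = rep_hgerm g"
    have F: "hol_near0 F" "abs_hgerm F = g" by (simp_all add: F_def hol_near0_rep_hgerm)
    obtain r where r: "r > 0" "\<And>z. z \<in> ball 0 r \<Longrightarrow> cdiff_at F z"
      using F(1) by (auto simp: hol_near0_def eventually_nhds_metric dist_commute)
    have "hol_near0 ((directional v ^^ k) F) \<and> abs_hgerm ((directional v ^^ k) F) \<in> I" for v k
      by (induction k) (use F g directional in auto)
    hence "(directional v ^^ k) F 0 = 0" for v k
      using vanish[of "abs_hgerm ((directional v ^^ k) F)"] by (simp add: germ_value_abs)
    hence "F v = 0" if "v \<in> ball 0 r" for v
      using zero_on_ball_if_directional_derivatives_vanish[OF r(2)] that by blast
    hence "\<forall>\<^sub>F z in nhds 0. F z = 0"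
      using eventually_nhds_in_open[of "ball 0 r" "0 :: complex^'n"] r(1)
      by (auto elim: eventually_mono)
    hence "abs_hgerm F = abs_hgerm (\<lambda>_. 0)" using F by (subst abs_hgerm_eq_iff) (auto intro: hol_near0_intros)
    thus ?thesis using F by (simp add: zero_hgerm_def)
  qed
  thus "I = {0}" using ideal_zero[OF I] by blast
qed

text \<open>The ring of germs is a domain by \<open>differentially_simple_imp_domain\<close>, as positive integers are units.\<close>

instance hgerm :: (finite) idom
proof
  fix a b :: "'a hgerm"
  assume "a \<noteq> 0" "b \<noteq> 0"
  moreover have "x = 0" if x: "of_nat (Suc k) * x = 0" for k and x :: "'a hgerm"
  proof -
    have "germ_value (of_nat (Suc k) :: 'a hgerm) \<noteq> 0" by (subst germ_value_of_nat) (rule of_nat_neq_0)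
    then obtain y :: "'a hgerm" where y: "1 = of_nat (Suc k) * y" unfolding germ_dvd_one_iff[symmetric] dvd_def by blast
    have "x = 1 * x" by simp
    also have "\<dots> = y * (of_nat (Suc k) * x)" unfolding y by (simp only: mult_ac)
    finally show ?thesis using x by simp
  qed
  ultimately show "a * b \<noteq> 0"
    using differentially_simple_imp_domain[OF germs_differentially_simple, of a b] by blast
qed


section \<open>Evaluation of polynomials\<close>

definition unital_hom :: "('a::comm_ring_1 \<Rightarrow> 'b::comm_ring_1) \<Rightarrow> bool" where
  "unital_hom h \<longleftrightarrow> h 1 = 1 \<and> (\<forall>x y. h (x + y) = h x + h y) \<and> (\<forall>x y. h (x * y) = h x * h y)"

context
  fixes h :: "'a::comm_ring_1 \<Rightarrow> 'b::comm_ring_1"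
  assumes h: "unital_hom h"
begin

lemma hom_one: "h 1 = 1"
  and hom_add: "h (x + y) = h x + h y"
  and hom_mult: "h (x * y) = h x * h y"
  using h by (auto simp: unital_hom_def)

lemma hom_zero: "h 0 = 0"
  using hom_add[of 0 0] by simp

lemma hom_uminus: "h (- x) = - h x"
  using hom_add[of x "- x"] by (simp add: hom_zero eq_neg_iff_add_eq_0 add.commute)

lemma hom_diff: "h (x - y) = h x - h y"
  using hom_add[of x "- y"] by (simp add: hom_uminus)

lemma hom_sum: "h (sum g S) = (\<Sum>i\<in>S. h (g i))"
  by (induction S rule: infinite_finite_induct) (simp_all add: hom_zero hom_add)

lemma hom_power: "h (x ^ k) = h x ^ k"
  by (induction k) (simp_all add: hom_one hom_mult)

lemma prime_ideal_preimage:
  assumes "prime_ideal P"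
  shows "prime_ideal {x. h x \<in> P}"
  using assms unfolding prime_ideal_def is_ideal_iff by (simp add: hom_one hom_zero hom_add hom_mult)

end

lemma unital_hom_comp: "unital_hom g \<Longrightarrow> unital_hom h \<Longrightarrow> unital_hom (\<lambda>x. g (h x))"
  by (simp add: unital_hom_def)

lemma prime_ideal_zero: "prime_ideal {0 :: 'a::idom}"
  by (auto simp: prime_ideal_def is_ideal_zero)

lemma prime_ideal_kernel:
  fixes h :: "'a::comm_ring_1 \<Rightarrow> 'b::idom"
  shows "unital_hom h \<Longrightarrow> prime_ideal {x. h x = 0}"
  using prime_ideal_preimage[OF _ prime_ideal_zero] by fastforce

lemma poly_mapping_single_induct [case_names zero single add]:
  assumes "P 0" "\<And>k a. P (Poly_Mapping.single k a)" "\<And>p q. P p \<Longrightarrow> P q \<Longrightarrow> P (p + q)"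
  shows "P (p :: 'k \<Rightarrow>\<^sub>0 'a::comm_monoid_add)"
proof (induction p rule: update_induct)
  case (update p k a)
  have "Poly_Mapping.update k a p = p + Poly_Mapping.single k a"
    using update(1) by (intro poly_mapping_eqI)
      (auto simp: lookup_update lookup_add lookup_single when_def in_keys_iff)
  thus ?case using assms update by simp
qed (fact assms(1))

definition monom_value :: "('v \<Rightarrow> 'c::comm_ring_1) \<Rightarrow> ('v \<Rightarrow>\<^sub>0 nat) \<Rightarrow> 'c" where
  "monom_value y m = (\<Prod>v\<in>Poly_Mapping.keys m. y v ^ Poly_Mapping.lookup m v)"

definition poly_eval ::
    "('a::comm_ring_1 \<Rightarrow> 'c::comm_ring_1) \<Rightarrow> ('v \<Rightarrow> 'c) \<Rightarrow> (('v \<Rightarrow>\<^sub>0 nat) \<Rightarrow>\<^sub>0 'a) \<Rightarrow> 'c" where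
  "poly_eval \<iota> y p = (\<Sum>m\<in>Poly_Mapping.keys p. \<iota> (Poly_Mapping.lookup p m) * monom_value y m)"

lemma monom_value_superset:
  "finite S \<Longrightarrow> Poly_Mapping.keys m \<subseteq> S \<Longrightarrow> monom_value y m = (\<Prod>v\<in>S. y v ^ Poly_Mapping.lookup m v)"
  unfolding monom_value_def by (rule prod.mono_neutral_left) (auto simp: in_keys_iff)

lemma monom_value_add: "monom_value y (m + m') = monom_value y m * monom_value y m'"
proof -
  let ?S = "Poly_Mapping.keys m \<union> Poly_Mapping.keys m'"
  have "monom_value y (m + m') = (\<Prod>v\<in>?S. y v ^ Poly_Mapping.lookup (m + m') v)"
    using keys_add[of m m'] by (intro monom_value_superset) auto
  also have "\<dots> = monom_value y m * monom_value y m'"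
    by (simp add: monom_value_superset[of ?S] lookup_add power_add prod.distrib)
  finally show ?thesis .
qed

lemma monom_value_single: "monom_value y (Poly_Mapping.single v k) = y v ^ k"
  by (cases "k = 0") (simp_all add: monom_value_def)

context
  fixes \<iota> :: "'a::comm_ring_1 \<Rightarrow> 'c::comm_ring_1" and y :: "'v \<Rightarrow> 'c"
  assumes \<iota>: "unital_hom \<iota>"
begin

lemma poly_eval_superset:
  "finite S \<Longrightarrow> Poly_Mapping.keys p \<subseteq> S \<Longrightarrow>
     poly_eval \<iota> y p = (\<Sum>m\<in>S. \<iota> (Poly_Mapping.lookup p m) * monom_value y m)"
  unfolding poly_eval_def by (rule sum.mono_neutral_left) (auto simp: in_keys_iff hom_zero[OF \<iota>])

lemma poly_eval_add: "poly_eval \<iota> y (p + q) = poly_eval \<iota> y p + poly_eval \<iota> y q"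
proof -
  let ?S = "Poly_Mapping.keys p \<union> Poly_Mapping.keys q"
  have "poly_eval \<iota> y (p + q) = (\<Sum>m\<in>?S. \<iota> (Poly_Mapping.lookup (p + q) m) * monom_value y m)"
    using keys_add[of p q] by (intro poly_eval_superset) auto
  also have "\<dots> = poly_eval \<iota> y p + poly_eval \<iota> y q"
    by (simp add: poly_eval_superset[of ?S] lookup_add hom_add[OF \<iota>] distrib_right sum.distrib)
  finally show ?thesis .
qed

lemma poly_eval_single: "poly_eval \<iota> y (Poly_Mapping.single m a) = \<iota> a * monom_value y m"
  by (cases "a = 0") (simp_all add: poly_eval_def hom_zero[OF \<iota>])

lemma poly_eval_const: "poly_eval \<iota> y (Poly_Mapping.single 0 a) = \<iota> a"
  by (simp add: poly_eval_single monom_value_def)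

lemma poly_eval_var: "poly_eval \<iota> y (Poly_Mapping.single (Poly_Mapping.single v 1) 1) = y v"
  by (simp add: poly_eval_single monom_value_single hom_one[OF \<iota>])

lemma unital_hom_poly_eval: "unital_hom (poly_eval \<iota> y)"
proof -
  have z: "poly_eval \<iota> y 0 = 0" by (simp add: poly_eval_def)
  have "poly_eval \<iota> y (Poly_Mapping.single m a * q) = poly_eval \<iota> y (Poly_Mapping.single m a) * poly_eval \<iota> y q"
    for m a q
  proof (induction q rule: poly_mapping_single_induct)
    case (single m' b)
    show ?case by (simp add: mult_single poly_eval_single monom_value_add hom_mult[OF \<iota>] mult_ac)
  next
    case (add q q')
    thus ?case by (simp only: distrib_left poly_eval_add)
  qed (simp add: z)
  hence "poly_eval \<iota> y (p * q) = poly_eval \<iota> y p * poly_eval \<iota> y q" for p q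
    by (induction p rule: poly_mapping_single_induct) (simp_all add: z poly_eval_add distrib_right)
  moreover have "poly_eval \<iota> y 1 = 1"
    using poly_eval_const[of 1] by (simp add: hom_one[OF \<iota>])
  ultimately show ?thesis by (simp add: unital_hom_def poly_eval_add)
qed

end

lemma unital_hom_eqI:
  fixes g h :: "(('v \<Rightarrow>\<^sub>0 nat) \<Rightarrow>\<^sub>0 'a::comm_ring_1) \<Rightarrow> 'c::comm_ring_1"
  assumes g: "unital_hom g" and h: "unital_hom h"
    and const: "\<And>a. g (Poly_Mapping.single 0 a) = h (Poly_Mapping.single 0 a)"
    and var: "\<And>v. g (Poly_Mapping.single (Poly_Mapping.single v 1) 1)
                 = h (Poly_Mapping.single (Poly_Mapping.single v 1) 1)"
  shows "g p = h p"
proof -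
  have "g (Poly_Mapping.single m 1) = h (Poly_Mapping.single m 1)" for m
  proof (induction m rule: poly_mapping_single_induct)
    case (single v k)
    show ?case
    proof (induction k)
      case (Suc k)
      have "Poly_Mapping.single (Poly_Mapping.single v (Suc k)) (1::'a)
         = Poly_Mapping.single (Poly_Mapping.single v 1) 1 * Poly_Mapping.single (Poly_Mapping.single v k) 1"
        by (simp add: mult_single single_add[symmetric])
      thus ?case using Suc by (simp only: hom_mult[OF g] hom_mult[OF h] var)
    qed (simp add: hom_one[OF g] hom_one[OF h])
  next
    case (add m m')
    have "Poly_Mapping.single (m + m') (1::'a) = Poly_Mapping.single m 1 * Poly_Mapping.single m' 1"
      by (simp add: mult_single)
    thus ?case using add by (simp only: hom_mult[OF g] hom_mult[OF h])
  qed (simp add: hom_one[OF g] hom_one[OF h])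
  hence "g (Poly_Mapping.single m a) = h (Poly_Mapping.single m a)" for m a
    using const[of a] hom_mult[OF g, of "Poly_Mapping.single 0 a" "Poly_Mapping.single m 1"]
      hom_mult[OF h, of "Poly_Mapping.single 0 a" "Poly_Mapping.single m 1"]
    by (simp add: mult_single)
  thus ?thesis
    by (induction p rule: poly_mapping_single_induct)
       (simp_all add: hom_zero[OF g] hom_zero[OF h] hom_add[OF g] hom_add[OF h])
qed

lemma unital_hom_const: "unital_hom (Poly_Mapping.single 0 :: 'a::comm_ring_1 \<Rightarrow> ('v \<Rightarrow>\<^sub>0 nat) \<Rightarrow>\<^sub>0 'a)"
  by (simp add: unital_hom_def single_add mult_single)

lemma unital_hom_pCons: "unital_hom (\<lambda>c :: 'a::comm_ring_1. [:c:])"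
  by (simp add: unital_hom_def one_pCons)

lemma unital_hom_spconst: "unital_hom spconst"
  by (simp add: unital_hom_def spconst_def single_add mult_single)

text \<open>
  The lowest coefficients of \<open>a\<close> and \<open>b\<close> outside \<open>q\<close> multiply to a coefficient of \<open>a b\<close> outside \<open>q\<close>.
\<close>

lemma prime_ideal_poly_coeffs:
  fixes q :: "'a::comm_ring_1 set"
  assumes q: "prime_ideal q"
  shows "prime_ideal {p. \<forall>i. Polynomial.coeff p i \<in> q}"
proof -
  note I = prime_is_ideal[OF q]
  let ?P = "{p. \<forall>i. Polynomial.coeff p i \<in> q}"
  have "is_ideal ?P" unfolding is_ideal_iff
    using I by (auto simp: coeff_mult intro!: ideal_sum ideal_mult_left intro: ideal_zero ideal_add)
  moreover have "1 \<notin> ?P" using prime_one_notin[OF q] by (auto intro!: exI[of _ 0])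
  moreover have "a * b \<notin> ?P" if ab: "a \<notin> ?P" "b \<notin> ?P" for a b
  proof -
    obtain i where i: "Polynomial.coeff a i \<notin> q" "\<And>k. k < i \<Longrightarrow> Polynomial.coeff a k \<in> q"
      using ab(1) exists_least_iff[of "\<lambda>i. Polynomial.coeff a i \<notin> q"] by auto
    obtain j where j: "Polynomial.coeff b j \<notin> q" "\<And>k. k < j \<Longrightarrow> Polynomial.coeff b k \<in> q"
      using ab(2) exists_least_iff[of "\<lambda>i. Polynomial.coeff b i \<notin> q"] by auto
    have "Polynomial.coeff (a * b) (i + j) =
        (\<Sum>k\<in>{..i + j} - {i}. Polynomial.coeff a k * Polynomial.coeff b (i + j - k))
        + Polynomial.coeff a i * Polynomial.coeff b j"
      unfolding coeff_mult by (subst sum.remove[of _ i]) (simp_all add: add.commute)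
    moreover have "(\<Sum>k\<in>{..i + j} - {i}. Polynomial.coeff a k * Polynomial.coeff b (i + j - k)) \<in> q"
    proof (rule ideal_sum[OF I])
      fix k assume k: "k \<in> {..i + j} - {i}"
      show "Polynomial.coeff a k * Polynomial.coeff b (i + j - k) \<in> q"
      proof (cases "k < i")
        case True thus ?thesis using i(2) ideal_mult_right[OF I] by blast
      next
        case False
        hence "i + j - k < j" using k by auto
        thus ?thesis using j(2) ideal_mult_left[OF I] by blast
      qed
    qed
    moreover have "Polynomial.coeff a i * Polynomial.coeff b j \<notin> q"
      using i(1) j(1) prime_mult[OF q] by blast
    ultimately have "Polynomial.coeff (a * b) (i + j) \<notin> q"
      using ideal_add_cancel_left[OF I] by metis
    thus ?thesis by blast
  qed
  ultimately show ?thesis by (auto simp: prime_ideal_def)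
qed

lemma rees_map_eq_poly_eval: "rees_map f = poly_eval (\<lambda>c. [:c:]) (rees_gen f)"
  by (simp add: fun_eq_iff rees_map_def poly_eval_def monom_value_def)

lemma unital_hom_rees_map: "unital_hom (rees_map f)"
  unfolding rees_map_eq_poly_eval by (intro unital_hom_poly_eval unital_hom_pCons)

lemma rees_map_spconst: "rees_map f (spconst c) = [:c:]"
  unfolding rees_map_eq_poly_eval spconst_def by (rule poly_eval_const[OF unital_hom_pCons])

lemma rees_map_spvar: "rees_map f (spvar v) = rees_gen f v"
  unfolding rees_map_eq_poly_eval spvar_def by (rule poly_eval_var[OF unital_hom_pCons])


section \<open>A chain of primes below the Rees kernel\<close>

text \<open>
  Numbering the variables makes the monomials linearly ordered, and so the polynomial ring is a domain.
\<close>

abbreviation mpvar :: "nat \<Rightarrow> (nat \<Rightarrow>\<^sub>0 nat) \<Rightarrow>\<^sub>0 'a::comm_ring_1" where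
  "mpvar i \<equiv> Poly_Mapping.single (Poly_Mapping.single i 1) 1"

abbreviation mpconst :: "'a::comm_ring_1 \<Rightarrow> (nat \<Rightarrow>\<^sub>0 nat) \<Rightarrow>\<^sub>0 'a" where
  "mpconst \<equiv> Poly_Mapping.single 0"

lemma prime_height_ge:
  assumes "\<And>i. i \<le> k \<Longrightarrow> prime_ideal (C i)" "\<And>i. i < k \<Longrightarrow> C i \<subset> C (Suc i)" "C k = P"
  shows "enat k \<le> prime_height P"
  unfolding prime_height_def using assms by (intro Sup_upper) blast

text \<open>
  Over the fraction field the kernel of \<open>rees_map f\<close> is generated by the linear forms
  \<open>f \<xi>\<^sub>j - f\<^sub>j s\<close>.  Imposing them one after the other gives a chain of \<open>n + 1\<close> primes:
  the \<open>k\<close>-th is the kernel of the substitution that sends \<open>s\<close> to \<open>f z\<^sub>0\<close>, the first \<open>k\<close> of the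
  \<open>\<xi>\<^sub>j\<close> to \<open>f\<^sub>j z\<^sub>0\<close>, and the others to independent variables.
\<close>

lemma prime_height_over_rees_kernel:
  fixes f :: "'n::finite hgerm"
  assumes f: "f \<noteq> 0" and P: "prime_ideal P" "rees_ker f \<subseteq> P" "spconst f \<in> P"
  shows "enat (CARD('n) + 1) \<le> prime_height P"
proof -
  define n where "n = CARD('n)"
  obtain idx :: "'n \<Rightarrow> nat" where idx: "bij_betw idx UNIV {0..<n}"
    using ex_bij_betw_finite_nat[of "UNIV :: 'n set"] by (auto simp: n_def)
  define val :: "nat \<Rightarrow> 'n symvar \<Rightarrow> (nat \<Rightarrow>\<^sub>0 nat) \<Rightarrow>\<^sub>0 'n hgerm" where
    "val k v = (case v of Ess \<Rightarrow> mpconst f * mpvar 0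
       | Xi j \<Rightarrow> if idx j < k then mpconst (pderiv_germ j f) * mpvar 0 else mpvar (Suc (idx j)))" for k v
  define g where "g k = poly_eval mpconst (val k)" for k
  define Q where "Q k = {p. g k p = 0}" for k
  have hom: "unital_hom (g k)" for k
    unfolding g_def by (intro unital_hom_poly_eval unital_hom_const)
  have g_const: "g k (spconst c) = mpconst c" and g_var: "g k (spvar v) = val k v" for k c v
    by (simp_all add: g_def spconst_def spvar_def poly_eval_const[OF unital_hom_const]
          poly_eval_var[OF unital_hom_const, simplified])
  have prime: "prime_ideal (Q k)" for k
    unfolding Q_def by (rule prime_ideal_kernel[OF hom])
  have strict: "Q k \<subset> Q (Suc k)" if k: "k < n" for k
  proof -
    have "k \<in> range idx" using k idx by (simp add: bij_betw_def)
    then obtain j where j: "idx j = k" by blast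
    have j_unique: "j' = j" if "idx j' = k" for j' using j that idx by (auto simp: bij_betw_def inj_def)
    \<comment> \<open>The next substitution factors through the present one: \<open>z\<close> with index \<open>Suc k\<close> goes to \<open>f\<^sub>j z\<^sub>0\<close>.\<close>
    define \<theta> where "\<theta> = poly_eval mpconst (\<lambda>i. if i = Suc k then mpconst (pderiv_germ j f) * mpvar 0 else mpvar i)"
    have \<theta>: "unital_hom \<theta>"
      unfolding \<theta>_def by (intro unital_hom_poly_eval unital_hom_const)
    have \<theta>_const: "\<theta> (mpconst c) = mpconst c" for c
      unfolding \<theta>_def by (rule poly_eval_const[OF unital_hom_const])
    have \<theta>_var: "\<theta> (mpvar i) = (if i = Suc k then mpconst (pderiv_germ j f) * mpvar 0 else mpvar i)" for i
      unfolding \<theta>_def by (rule poly_eval_var[OF unital_hom_const])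
    have step: "\<theta> (g k p) = g (Suc k) p" for p
    proof (rule unital_hom_eqI[OF unital_hom_comp[OF \<theta> hom] hom])
      show "\<theta> (g k (Poly_Mapping.single 0 a)) = g (Suc k) (Poly_Mapping.single 0 a)" for a
        using g_const by (simp add: spconst_def \<theta>_const)
      have "\<theta> (val k v) = val (Suc k) v" for v
      proof (cases v)
        case (Xi j')
        consider "idx j' < k" | "idx j' = k" | "idx j' > k" by linarith
        thus ?thesis
        proof cases
          case 2
          thus ?thesis using Xi j_unique[OF 2] by (simp add: val_def \<theta>_var[simplified])
        qed (simp_all add: Xi val_def hom_mult[OF \<theta>] \<theta>_const \<theta>_var[simplified])
      qed (simp add: val_def hom_mult[OF \<theta>] \<theta>_const \<theta>_var[simplified])
      thus "\<theta> (g k (Poly_Mapping.single (Poly_Mapping.single v 1) 1))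
            = g (Suc k) (Poly_Mapping.single (Poly_Mapping.single v 1) 1)" for v
        using g_var by (simp add: spvar_def)
    qed
    hence "Q k \<subseteq> Q (Suc k)" by (auto simp: Q_def step[symmetric] hom_zero[OF \<theta>])
    moreover
    define w where "w = spconst f * spvar (Xi j) - spconst (pderiv_germ j f) * spvar Ess"
    have gw: "g i w = mpconst f * val i (Xi j) - mpconst (pderiv_germ j f) * (mpconst f * mpvar 0)" for i
      by (simp add: w_def hom_diff[OF hom] hom_mult[OF hom] g_const g_var) (simp add: val_def)
    have "w \<in> Q (Suc k)" by (simp add: Q_def gw val_def j mult_ac)
    moreover have "w \<notin> Q k"
    proof
      assume "w \<in> Q k"
      hence "mpconst f * mpvar (Suc k) - mpconst (pderiv_germ j f) * (mpconst f * mpvar 0) = 0"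
        by (simp only: Q_def gw val_def j mem_Collect_eq symvar.case less_irrefl if_False)
      from arg_cong[OF this, of "\<lambda>p. Poly_Mapping.lookup p (Poly_Mapping.single (Suc k) 1)"]
      moreover have "Poly_Mapping.single 0 (Suc 0) \<noteq> Poly_Mapping.single (Suc k) (Suc 0)"
        by (metis lookup_single_eq lookup_single_not_eq nat.distinct(1))
      ultimately show False using f by (simp add: lookup_minus mult_single lookup_single when_def)
    qed
    ultimately show ?thesis by blast
  qed
  have below: "Q n \<subseteq> rees_ker f"
  proof -
    \<comment> \<open>Only \<open>z\<^sub>0\<close> is left in the image of \<open>g n\<close>; it becomes the grading variable of the Rees algebra.\<close>
    define \<tau> where "\<tau> = poly_eval (\<lambda>c :: 'n hgerm. [:c:]) (\<lambda>_ :: nat. Polynomial.monom 1 1)"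
    have \<tau>: "unital_hom \<tau>"
      unfolding \<tau>_def by (intro unital_hom_poly_eval unital_hom_pCons)
    have \<tau>_const: "\<tau> (mpconst c) = [:c:]" for c
      unfolding \<tau>_def by (rule poly_eval_const[OF unital_hom_pCons])
    have \<tau>_var: "\<tau> (mpvar i) = Polynomial.monom 1 1" for i
      unfolding \<tau>_def by (rule poly_eval_var[OF unital_hom_pCons])
    have step: "\<tau> (g n p) = rees_map f p" for p
    proof (rule unital_hom_eqI[OF unital_hom_comp[OF \<tau> hom] unital_hom_rees_map])
      show "\<tau> (g n (Poly_Mapping.single 0 a)) = rees_map f (Poly_Mapping.single 0 a)" for a
        using g_const rees_map_spconst[of f a] by (simp add: spconst_def \<tau>_const)
      have "idx j < n" for j using idx by (auto simp: bij_betw_def)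
      hence "\<tau> (val n v) = rees_gen f v" for v
        by (cases v) (simp_all add: val_def hom_mult[OF \<tau>] \<tau>_const \<tau>_var[simplified] smult_monom)
      thus "\<tau> (g n (Poly_Mapping.single (Poly_Mapping.single v 1) 1))
            = rees_map f (Poly_Mapping.single (Poly_Mapping.single v 1) 1)" for v
        using g_var rees_map_spvar[of f v] by (simp add: spvar_def)
    qed
    thus ?thesis by (auto simp: Q_def rees_ker_def step[symmetric] hom_zero[OF \<tau>])
  qed
  have "spconst f \<notin> rees_ker f" using f by (simp add: rees_ker_def rees_map_spconst)
  hence "Q n \<subset> P" using below P by blast
  define C where "C = (\<lambda>k. if k \<le> n then Q k else P)"
  have "prime_ideal (C i)" for i using prime P(1) by (simp add: C_def)
  moreover have "C i \<subset> C (Suc i)" if "i < n + 1" for i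
  proof (cases "i = n")
    case True thus ?thesis using \<open>Q n \<subset> P\<close> by (simp add: C_def)
  next
    case False thus ?thesis using strict[of i] that by (simp add: C_def)
  qed
  moreover have "C (n + 1) = P" by (simp add: C_def)
  ultimately show ?thesis unfolding n_def[symmetric] by (rule prime_height_ge)
qed


section \<open>Algebraic independence modulo a prime\<close>

text \<open>Gaussian elimination, with cross-multiplication in place of division.\<close>

lemma underdetermined_system_nontrivial_solution:
  fixes a :: "'e \<Rightarrow> 'i \<Rightarrow> 'a::idom"
  assumes "finite E" "finite I" "card E < card I"
  shows "\<exists>x. (\<exists>i\<in>I. x i \<noteq> 0) \<and> (\<forall>e\<in>E. (\<Sum>i\<in>I. a e i * x i) = 0)"
  using assms
proof (induction E arbitrary: I a rule: finite_induct)
  case empty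
  hence "I \<noteq> {}" by auto
  thus ?case by (intro exI[of _ "\<lambda>_. 1"]) auto
next
  case (insert e E)
  show ?case
  proof (cases "\<forall>i\<in>I. a e i = 0")
    case True
    have "card E < card I" using insert by simp
    from insert.IH[OF insert.prems(1) this, of a] show ?thesis using True by (simp add: insert.hyps)
  next
    case False
    then obtain i0 where i0: "i0 \<in> I" "a e i0 \<noteq> 0" by blast
    define J where "J = I - {i0}"
    have J: "finite J" "i0 \<notin> J" "I = insert i0 J" using insert.prems i0 by (auto simp: J_def)
    hence "card E < card J" using insert by simp
    from insert.IH[OF J(1) this, of "\<lambda>e' i. a e i0 * a e' i - a e' i0 * a e i"]
    obtain x where x: "\<exists>i\<in>J. x i \<noteq> 0"
      "\<And>e'. e' \<in> E \<Longrightarrow> (\<Sum>i\<in>J. (a e i0 * a e' i - a e' i0 * a e i) * x i) = 0" by blast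
    define x' where "x' = (\<lambda>i. if i = i0 then - (\<Sum>i\<in>J. a e i * x i) else a e i0 * x i)"
    have sum_x': "(\<Sum>i\<in>I. a e' i * x' i)
        = (\<Sum>i\<in>J. (a e i0 * a e' i - a e' i0 * a e i) * x i)" for e'
    proof -
      have "(\<Sum>i\<in>J. a e' i * x' i) = (\<Sum>i\<in>J. a e' i * (a e i0 * x i))"
        using J(2) by (intro sum.cong) (auto simp: x'_def)
      hence "(\<Sum>i\<in>I. a e' i * x' i)
          = (\<Sum>i\<in>J. a e' i * (a e i0 * x i)) - a e' i0 * (\<Sum>i\<in>J. a e i * x i)"
        using J by (simp add: x'_def)
      thus ?thesis by (simp add: sum_distrib_left sum_subtractf algebra_simps)
    qed
    have "\<exists>i\<in>I. x' i \<noteq> 0" using x(1) i0 J by (auto simp: x'_def)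
    moreover have "(\<Sum>i\<in>I. a e' i * x' i) = 0" if "e' \<in> insert e E" for e'
      using that x(2) unfolding sum_x' by (cases "e' = e") (auto simp: mult.commute)
    ultimately show ?thesis by blast
  qed
qed

text \<open>
  The residue classes of \<open>h 0\<close>, ..., \<open>h (M - 1)\<close> in the quotient by \<open>Q\<close> are algebraically independent
  over the image of the coefficients.  A relation involves finitely many monomials, so families of
  coefficients on all boxes of exponent vectors \<open>e\<close> with \<open>e i < L\<close> for \<open>i < M\<close> account for every one.
\<close>

definition exponent_box :: "nat \<Rightarrow> nat \<Rightarrow> (nat \<Rightarrow> nat) set" where
  "exponent_box M L = {..<M} \<rightarrow>\<^sub>E {..<L}"

definition power_product :: "nat \<Rightarrow> (nat \<Rightarrow> 'r::comm_ring_1) \<Rightarrow> (nat \<Rightarrow> nat) \<Rightarrow> 'r" where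
  "power_product M h e = (\<Prod>i<M. h i ^ e i)"

definition alg_indep_mod ::
    "('a::comm_ring_1 \<Rightarrow> 'r::comm_ring_1) \<Rightarrow> 'r set \<Rightarrow> nat \<Rightarrow> (nat \<Rightarrow> 'r) \<Rightarrow> bool" where
  "alg_indep_mod \<iota> Q M h \<longleftrightarrow>
     (\<forall>L c. (\<Sum>e\<in>exponent_box M L. \<iota> (c e) * power_product M h e) \<in> Q \<longrightarrow>
        (\<forall>e\<in>exponent_box M L. \<iota> (c e) \<in> Q))"

lemma finite_exponent_box: "finite (exponent_box M L)"
  by (simp add: exponent_box_def finite_PiE)

lemma card_exponent_box: "card (exponent_box M L) = L ^ M"
  by (simp add: exponent_box_def card_PiE)

lemma sum_exponent_box_Suc:
  "(\<Sum>e\<in>exponent_box (Suc M) L. F e) = (\<Sum>j<L. \<Sum>e\<in>exponent_box M L. F (e(M := j)))"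
proof -
  have "exponent_box (Suc M) L = (\<lambda>(j, e). e(M := j)) ` ({..<L} \<times> exponent_box M L)"
    by (simp add: exponent_box_def lessThan_Suc PiE_insert_eq)
  moreover have "inj_on (\<lambda>(j, e). e(M := j)) ({..<L} \<times> exponent_box M L)"
    unfolding exponent_box_def by (rule inj_combinator) simp
  ultimately show ?thesis
    by (simp add: sum.reindex sum.cartesian_product case_prod_unfold comp_def)
qed

lemma power_product_Suc:
  "power_product (Suc M) (h(M := u)) (e(M := j)) = u ^ j * power_product M h e"
proof -
  have "(\<Prod>i<M. (h(M := u)) i ^ (e(M := j)) i) = (\<Prod>i<M. h i ^ e i)"
    by (intro prod.cong) auto
  thus ?thesis by (simp add: power_product_def mult.commute)
qed

lemma exponent_box_SucE:
  assumes "e \<in> exponent_box (Suc M) L"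
  obtains e' j where "e' \<in> exponent_box M L" "j < L" "e = e'(M := j)"
  using assms by (auto simp: exponent_box_def lessThan_Suc PiE_insert_eq)

text \<open>
  An element \<open>u\<close> of \<open>Q' - Q\<close> is transcendental modulo \<open>Q\<close> over anything that is independent modulo
  \<open>Q'\<close>: the constant term of a relation lies in \<open>Q'\<close>, so its coefficients lie in the common
  contraction, and the rest is divisible by \<open>u\<close>.
\<close>

lemma alg_indep_mod_extend:
  fixes \<iota> :: "'a::comm_ring_1 \<Rightarrow> 'r::comm_ring_1"
  assumes Q: "prime_ideal Q" "prime_ideal Q'" "Q \<subset> Q'"
    and contr: "\<And>c. \<iota> c \<in> Q' \<Longrightarrow> \<iota> c \<in> Q"
    and indep: "alg_indep_mod \<iota> Q' M h"
  obtains u where "alg_indep_mod \<iota> Q (Suc M) (h(M := u))"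
proof -
  obtain u where u: "u \<in> Q'" "u \<notin> Q" using Q(3) by blast
  note I = prime_is_ideal[OF Q(1)] and I' = prime_is_ideal[OF Q(2)]
  have "alg_indep_mod \<iota> Q (Suc M) (h(M := u))"
    unfolding alg_indep_mod_def
  proof (intro allI impI)
    fix L c
    assume rel: "(\<Sum>e\<in>exponent_box (Suc M) L. \<iota> (c e) * power_product (Suc M) (h(M := u)) e) \<in> Q"
    define G where "G d = (\<Sum>e\<in>exponent_box M L. \<iota> (d e) * power_product M h e)" for d
    have G: "\<iota> (d e) \<in> Q" if "G d \<in> Q'" "e \<in> exponent_box M L" for d e
      using indep that contr by (auto simp: alg_indep_mod_def G_def)
    have all: "\<forall>j<K. \<forall>e\<in>exponent_box M L. \<iota> (d j e) \<in> Q" if "(\<Sum>j<K. u ^ j * G (d j)) \<in> Q" for K d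
      using that
    proof (induction K arbitrary: d)
      case (Suc K)
      define S where "S = (\<Sum>j<K. u ^ j * G (d (Suc j)))"
      have split: "(\<Sum>j<Suc K. u ^ j * G (d j)) = u * S + G (d 0)"
        by (simp add: sum.lessThan_Suc_shift S_def sum_distrib_left mult_ac del: sum.lessThan_Suc)
      have "G (d 0) \<in> Q'"
        using Suc.prems Q(3) ideal_add_cancel_left[OF I' ideal_mult_right[OF I' u(1)], of S "G (d 0)"]
        unfolding split by blast
      from G[OF this] have zero: "\<iota> (d 0 e) \<in> Q" if "e \<in> exponent_box M L" for e using that by simp
      hence "G (d 0) \<in> Q" unfolding G_def by (intro ideal_sum[OF I] ideal_mult_right[OF I])
      hence "u * S \<in> Q"
        using Suc.prems ideal_add_cancel_left[OF I, of "G (d 0)" "u * S"]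
        unfolding split by (simp add: add.commute)
      hence "S \<in> Q" using prime_mult[OF Q(1)] u(2) by blast
      with Suc.IH[of "\<lambda>j. d (Suc j)"] zero show ?case unfolding S_def
        by (auto simp: less_Suc_eq_0_disj)
    qed simp
    have "(\<Sum>j<L. u ^ j * G (\<lambda>e. c (e(M := j)))) \<in> Q"
      using rel unfolding sum_exponent_box_Suc power_product_Suc G_def sum_distrib_left
      by (simp add: mult_ac)
    hence *: "\<iota> (c (e(M := j))) \<in> Q" if "j < L" "e \<in> exponent_box M L" for j e
      using all[of "\<lambda>j e. c (e(M := j))" L] that by simp
    show "\<forall>e\<in>exponent_box (Suc M) L. \<iota> (c e) \<in> Q"
    proof
      fix e assume e: "e \<in> exponent_box (Suc M) L"
      obtain e' j where "e' \<in> exponent_box M L" "j < L" "e = e'(M := j)"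
        by (rule exponent_box_SucE[OF e])
      thus "\<iota> (c e) \<in> Q" using *[of j e'] by simp
    qed
  qed
  thus ?thesis by (rule that)
qed

text \<open>
  When the contraction jumps from \<open>0\<close> to \<open>q\<close>, independence is kept: a relation modulo the smaller
  prime can be divided by its content and then gives a nontrivial relation modulo the larger one.
\<close>

lemma (in generic_component) alg_indep_mod_generic:
  fixes \<iota> :: "'a \<Rightarrow> 'r::comm_ring_1"
  assumes \<iota>: "unital_hom \<iota>" and Q: "prime_ideal Q" "Q \<subseteq> Q'"
    and contr: "\<And>c. \<iota> c \<in> Q \<longleftrightarrow> c = 0" "\<And>c. \<iota> c \<in> Q' \<Longrightarrow> c \<in> q"
    and indep: "alg_indep_mod \<iota> Q' M h"
  shows "alg_indep_mod \<iota> Q M h"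
  unfolding alg_indep_mod_def
proof (intro allI impI)
  fix L c
  assume rel: "(\<Sum>e\<in>exponent_box M L. \<iota> (c e) * power_product M h e) \<in> Q"
  note I = prime_is_ideal[OF Q(1)]
  show "\<forall>e\<in>exponent_box M L. \<iota> (c e) \<in> Q"
  proof (rule ccontr)
    assume "\<not> ?thesis"
    then obtain e where e: "e \<in> exponent_box M L" "c e \<noteq> 0" by (auto simp: contr)
    obtain a k c' where a: "a \<notin> q"
      and c': "\<And>e. e \<in> exponent_box M L \<Longrightarrow> a * c e = f ^ k * c' e"
      and prim: "\<exists>e\<in>exponent_box M L. c' e \<notin> q"
      by (rule primitive_part[where c = c, OF finite_exponent_box e]) (rule that)
    have "\<iota> a * (\<Sum>e\<in>exponent_box M L. \<iota> (c e) * power_product M h e)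
        = \<iota> f ^ k * (\<Sum>e\<in>exponent_box M L. \<iota> (c' e) * power_product M h e)"
      unfolding sum_distrib_left
    proof (rule sum.cong[OF refl])
      fix e assume "e \<in> exponent_box M L"
      from arg_cong[OF c'[OF this], of \<iota>]
      show "\<iota> a * (\<iota> (c e) * power_product M h e) = \<iota> f ^ k * (\<iota> (c' e) * power_product M h e)"
        by (simp add: hom_mult[OF \<iota>] hom_power[OF \<iota>] mult.assoc[symmetric])
    qed
    hence "\<iota> f ^ k * (\<Sum>e\<in>exponent_box M L. \<iota> (c' e) * power_product M h e) \<in> Q"
      using ideal_mult_left[OF I rel, of "\<iota> a"] by simp
    moreover have "\<iota> f ^ k \<notin> Q"
      using prime_power[OF Q(1)] contr(1) f_nonzero by blast
    ultimately have "(\<Sum>e\<in>exponent_box M L. \<iota> (c' e) * power_product M h e) \<in> Q'"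
      using prime_mult[OF Q(1)] Q(2) by blast
    hence "\<forall>e\<in>exponent_box M L. \<iota> (c' e) \<in> Q'" using indep by (simp add: alg_indep_mod_def)
    moreover obtain e where "e \<in> exponent_box M L" "c' e \<notin> q" using prim by blast
    ultimately show False using contr(2)[of "c' e"] by simp
  qed
qed


section \<open>The number of independent polynomials\<close>

lemma symvar_UNIV: "(UNIV :: 'n symvar set) = insert Ess (range Xi)"
proof -
  have "v \<in> insert Ess (range Xi)" for v :: "'n symvar" by (cases v) auto
  thus ?thesis by blast
qed

lemma finite_symvar: "finite (UNIV :: 'n::finite symvar set)"
  by (simp add: symvar_UNIV)

lemma card_symvar: "card (UNIV :: 'n::finite symvar set) = CARD('n) + 1"
proof -
  have "card (range (Xi :: 'n \<Rightarrow> 'n symvar)) = CARD('n)" by (intro card_image) (simp add: inj_def)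
  thus ?thesis unfolding symvar_UNIV by (subst card_insert_disjoint) auto
qed

lemma finite_card_bounded_exponents:
  fixes D :: nat
  defines "B \<equiv> {m :: 'n::finite symvar \<Rightarrow>\<^sub>0 nat. \<forall>v. Poly_Mapping.lookup m v \<le> D}"
  shows "finite B" "card B \<le> (D + 1) ^ (CARD('n) + 1)"
proof -
  let ?F = "(UNIV :: 'n symvar set) \<rightarrow>\<^sub>E {..D}"
  have F: "finite ?F" by (intro finite_PiE finite_symvar) simp
  have "card ?F = (\<Prod>v\<in>(UNIV :: 'n symvar set). card {..D})" by (rule card_PiE[OF finite_symvar])
  also have "\<dots> = (D + 1) ^ (CARD('n) + 1)" unfolding prod_constant card_symvar by simp
  finally have card: "card ?F = (D + 1) ^ (CARD('n) + 1)" .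
  have inj: "inj_on Poly_Mapping.lookup B" by (intro inj_onI poly_mapping_eqI) simp
  have sub: "Poly_Mapping.lookup ` B \<subseteq> ?F" by (auto simp: B_def PiE_def extensional_def)
  show "finite B" using inj_on_finite[OF inj sub F] .
  show "card B \<le> (D + 1) ^ (CARD('n) + 1)" using card_inj_on_le[OF inj sub F] card by simp
qed

definition var_degree_le :: "nat \<Rightarrow> (('v \<Rightarrow>\<^sub>0 nat) \<Rightarrow>\<^sub>0 'a::zero) \<Rightarrow> bool" where
  "var_degree_le d p \<longleftrightarrow> (\<forall>m\<in>Poly_Mapping.keys p. \<forall>v. Poly_Mapping.lookup m v \<le> d)"

lemma var_degree_le_mult:
  fixes p q :: "('v \<Rightarrow>\<^sub>0 nat) \<Rightarrow>\<^sub>0 'a::comm_ring_1"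
  assumes "var_degree_le d p" "var_degree_le d' q"
  shows "var_degree_le (d + d') (p * q)"
  unfolding var_degree_le_def
proof
  fix m assume "m \<in> Poly_Mapping.keys (p * q)"
  then obtain a b where "m = a + b" "a \<in> Poly_Mapping.keys p" "b \<in> Poly_Mapping.keys q"
    using keys_mult[of p q] by blast
  thus "\<forall>v. Poly_Mapping.lookup m v \<le> d + d'"
    using assms by (auto simp: var_degree_le_def lookup_add intro: add_mono)
qed

lemma var_degree_le_one: "var_degree_le 0 (1 :: ('v \<Rightarrow>\<^sub>0 nat) \<Rightarrow>\<^sub>0 'a::comm_ring_1)"
  by (simp add: var_degree_le_def)

lemma var_degree_le_power:
  fixes p :: "('v \<Rightarrow>\<^sub>0 nat) \<Rightarrow>\<^sub>0 'a::comm_ring_1"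
  shows "var_degree_le d p \<Longrightarrow> var_degree_le (k * d) (p ^ k)"
  by (induction k) (auto simp: var_degree_le_one intro: var_degree_le_mult)

lemma var_degree_le_mono: "var_degree_le d p \<Longrightarrow> d \<le> d' \<Longrightarrow> var_degree_le d' p"
  unfolding var_degree_le_def using order_trans by blast

lemma var_degree_le_power_product:
  fixes h :: "nat \<Rightarrow> ('v \<Rightarrow>\<^sub>0 nat) \<Rightarrow>\<^sub>0 'a::comm_ring_1"
  assumes "\<And>i. i < M \<Longrightarrow> var_degree_le d (h i)" "\<And>i. i < M \<Longrightarrow> e i \<le> L"
  shows "var_degree_le (M * (L * d)) (power_product M h e)"
  using assms
proof (induction M)
  case (Suc M)
  have "var_degree_le (L * d) (h M ^ e M)"
    using var_degree_le_mono[OF var_degree_le_power, of d "h M" "e M"] Suc.prems by simp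
  from var_degree_le_mult[OF this, of "M * (L * d)" "power_product M h e"] Suc
  show ?case by (simp add: power_product_def mult.commute)
qed (simp add: power_product_def var_degree_le_one)

lemma var_degree_bounded:
  fixes p :: "('n::finite symvar \<Rightarrow>\<^sub>0 nat) \<Rightarrow>\<^sub>0 'a::zero"
  obtains d where "var_degree_le d p"
proof -
  define S where "S = (\<lambda>(m, v). Poly_Mapping.lookup m v) ` (Poly_Mapping.keys p \<times> (UNIV :: 'n symvar set))"
  have "finite S" by (simp add: S_def finite_symvar)
  hence "x \<le> Max S" if "x \<in> S" for x using that by simp
  moreover have "Poly_Mapping.lookup m v \<in> S" if "m \<in> Poly_Mapping.keys p" for m v
    using that unfolding S_def by (intro image_eqI[of _ _ "(m, v)"]) auto
  ultimately have "var_degree_le (Max S) p" by (auto simp: var_degree_le_def)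
  thus ?thesis by (rule that)
qed

lemma lookup_spconst_mult:
  "Poly_Mapping.lookup (spconst c * p) m = c * Poly_Mapping.lookup p m"
  unfolding spconst_def mult_map_scale_conv_mult[symmetric]
  by (simp add: map.rep_eq when_def)

text \<open>
  Among \<open>M > n + 1\<close> polynomials there are more power products with exponents below \<open>L\<close> than monomials
  that can occur in them: \<open>L\<^sup>M\<close> against \<open>O(L\<^sup>n\<^sup>+\<^sup>1)\<close>.
\<close>

lemma polynomials_satisfy_relation:
  fixes h :: "nat \<Rightarrow> 'n::finite symbol_poly"
  assumes M: "M > CARD('n) + 1"
  obtains L c where "(\<Sum>e\<in>exponent_box M L. spconst (c e) * power_product M h e) = 0"
    "\<exists>e\<in>exponent_box M L. c e \<noteq> 0"
proof -
  define N where "N = CARD('n) + 1"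
  have "\<exists>d. var_degree_le d (h i)" for i by (rule var_degree_bounded[of "h i"]) blast
  then obtain deg where deg: "\<And>i. var_degree_le (deg i) (h i)" by metis
  define d where "d = (\<Sum>i<M. deg i)"
  have d: "var_degree_le d (h i)" if "i < M" for i
    using deg that member_le_sum[of i "{..<M}" deg] unfolding d_def
    by (intro var_degree_le_mono[OF deg]) auto
  define L where "L = (M * d + 1) ^ N + 1"
  define D where "D = M * (L * d)"
  define B where "B = {m :: 'n symvar \<Rightarrow>\<^sub>0 nat. \<forall>v. Poly_Mapping.lookup m v \<le> D}"
  have B: "finite B" "card B \<le> (D + 1) ^ N"
    unfolding B_def N_def by (rule finite_card_bounded_exponents)+
  have L: "(M * d + 1) ^ N < L" "1 \<le> L" by (simp_all add: L_def)
  have "D + 1 \<le> (M * d + 1) * L" using L(2) by (simp add: D_def algebra_simps)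
  from power_mono[OF this zero_le, of N]
  have "(D + 1) ^ N \<le> (M * d + 1) ^ N * L ^ N" by (simp only: power_mult_distrib)
  also have "\<dots> < L * L ^ N" by (rule mult_strict_right_mono[OF L(1)]) (use L(2) in simp)
  also have "\<dots> = L ^ Suc N" by simp
  also have "\<dots> \<le> L ^ M" using M L(2) by (intro power_increasing) (simp_all add: N_def)
  finally have "card B < card (exponent_box M L)" using B(2) by (simp add: card_exponent_box)
  from underdetermined_system_nontrivial_solution[OF B(1) finite_exponent_box this,
      of "\<lambda>m e. Poly_Mapping.lookup (power_product M h e) m"]
  obtain c where c: "\<exists>e\<in>exponent_box M L. c e \<noteq> 0"
    "\<forall>m\<in>B. (\<Sum>e\<in>exponent_box M L. Poly_Mapping.lookup (power_product M h e) m * c e) = 0"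
    by (elim exE conjE)
  have "Poly_Mapping.lookup (\<Sum>e\<in>exponent_box M L. spconst (c e) * power_product M h e) m = 0" for m
  proof (cases "m \<in> B")
    case True
    thus ?thesis using c(2) by (simp add: lookup_sum lookup_spconst_mult mult.commute)
  next
    case False
    have "Poly_Mapping.lookup (power_product M h e) m = 0" if "e \<in> exponent_box M L" for e
    proof (rule ccontr)
      assume "Poly_Mapping.lookup (power_product M h e) m \<noteq> 0"
      moreover have "e i \<le> L" if "i < M" for i
        using \<open>e \<in> exponent_box M L\<close> that by (auto simp: exponent_box_def PiE_iff intro: less_imp_le)
      ultimately have "m \<in> B"
        using var_degree_le_power_product[of M d h e L] d
        by (simp add: B_def D_def var_degree_le_def in_keys_iff)
      thus False using False by simp
    qed
    thus ?thesis by (simp add: lookup_sum lookup_spconst_mult)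
  qed
  hence "(\<Sum>e\<in>exponent_box M L. spconst (c e) * power_product M h e) = 0"
    by (intro poly_mapping_eqI) simp
  thus ?thesis using c(1) by (rule that)
qed


text \<open>
  The relation is divided by its content, so that it remains nontrivial modulo \<open>q\<close> when the
  contraction of \<open>Q\<close> is \<open>q\<close>.
\<close>

lemma alg_indep_mod_bound:
  fixes f :: "'n::finite hgerm"
  assumes gc: "generic_component \<Delta> f q"
    and Q: "is_ideal Q" "\<And>c. spconst c \<in> Q \<Longrightarrow> c \<in> q"
    and indep: "alg_indep_mod spconst Q M h"
  shows "M \<le> CARD('n) + 1"
proof (rule ccontr)
  interpret generic_component \<Delta> f q by (fact gc)
  assume "\<not> ?thesis"
  hence "M > CARD('n) + 1" by simp
  then obtain L c where rel: "(\<Sum>e\<in>exponent_box M L. spconst (c e) * power_product M h e) = 0"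
    and "\<exists>e\<in>exponent_box M L. c e \<noteq> 0"
    by (rule polynomials_satisfy_relation)
  then obtain e where e: "e \<in> exponent_box M L" "c e \<noteq> 0" by blast
  obtain a k c' where a: "a \<notin> q"
    and c': "\<And>e. e \<in> exponent_box M L \<Longrightarrow> a * c e = f ^ k * c' e"
    and prim: "\<exists>e\<in>exponent_box M L. c' e \<notin> q"
    by (rule primitive_part[where c = c, OF finite_exponent_box e]) (rule that)
  define R where "R = (\<Sum>e\<in>exponent_box M L. spconst (c' e) * power_product M h e)"
  have "spconst (f ^ k) * R = spconst a * (\<Sum>e\<in>exponent_box M L. spconst (c e) * power_product M h e)"
    unfolding R_def sum_distrib_left
  proof (rule sum.cong[OF refl])
    fix e assume "e \<in> exponent_box M L"
    from arg_cong[OF c'[OF this], of spconst]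
    show "spconst (f ^ k) * (spconst (c' e) * power_product M h e)
        = spconst a * (spconst (c e) * power_product M h e)"
      by (simp add: hom_mult[OF unital_hom_spconst] mult.assoc[symmetric])
  qed
  hence "spconst (f ^ k) * R = 0" using rel by simp
  hence "f ^ k * Poly_Mapping.lookup R m = 0" for m
    using lookup_spconst_mult[of "f ^ k" R m] by simp
  hence "R = 0" using f_nonzero by (intro poly_mapping_eqI) simp
  hence "R \<in> Q" using ideal_zero[OF Q(1)] by simp
  hence "\<forall>e\<in>exponent_box M L. spconst (c' e) \<in> Q" using indep by (simp add: alg_indep_mod_def R_def)
  moreover obtain e where "e \<in> exponent_box M L" "c' e \<notin> q" using prim by blast
  ultimately show False using Q(2)[of "c' e"] by simp
qed


section \<open>The prime of the conormal space along a generic component\<close>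

text \<open>
  The kernel of \<open>rees_map f\<close> followed by reduction modulo \<open>q\<close>.  As \<open>f\<close> lies in \<open>q\<close>, it contains \<open>s\<close>, and
  it is the ideal of the closure of the conormal bundle of the component that belongs to \<open>q\<close>.
\<close>

definition conormal_prime :: "'n::finite hgerm \<Rightarrow> 'n hgerm set \<Rightarrow> 'n symbol_poly set" where
  "conormal_prime f q = {p. \<forall>i. Polynomial.coeff (rees_map f p) i \<in> q}"

lemma prime_ideal_conormal_prime: "prime_ideal q \<Longrightarrow> prime_ideal (conormal_prime f q)"
  using prime_ideal_preimage[OF unital_hom_rees_map prime_ideal_poly_coeffs, of q f]
  by (simp add: conormal_prime_def)

lemma spconst_in_conormal_prime_iff:
  assumes "prime_ideal q"
  shows "spconst c \<in> conormal_prime f q \<longleftrightarrow> c \<in> q"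
  using ideal_zero[OF prime_is_ideal[OF assms]]
  by (auto simp: conormal_prime_def rees_map_spconst coeff_pCons split: nat.splits)

lemma rees_ker_subset_conormal_prime: "prime_ideal q \<Longrightarrow> rees_ker f \<subseteq> conormal_prime f q"
  using ideal_zero[OF prime_is_ideal] by (auto simp: rees_ker_def conormal_prime_def)

text \<open>The quotient by \<open>conormal_prime f q\<close> has relative dimension at least one: \<open>\<xi>\<^sub>j\<close> maps to \<open>f\<^sub>j t\<close>.\<close>

lemma alg_indep_mod_conormal_prime:
  assumes q: "prime_ideal q" and j: "pderiv_germ j f \<notin> q"
  shows "alg_indep_mod spconst (conormal_prime f q) 1 (\<lambda>_. spvar (Xi j))"
  unfolding alg_indep_mod_def
proof (intro allI impI)
  fix L :: nat and c :: "(nat \<Rightarrow> nat) \<Rightarrow> 'a hgerm"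
  let ?h = "\<lambda>_::nat. spvar (Xi j)"
  let ?r = "\<Sum>e\<in>exponent_box 1 L. spconst (c e) * power_product 1 ?h e"
  assume rel: "?r \<in> conormal_prime f q"
  show "\<forall>e\<in>exponent_box 1 L. spconst (c e) \<in> conormal_prime f q"
  proof
  fix e0 assume e0: "e0 \<in> exponent_box 1 L"
  have inj: "e = e0" if "e \<in> exponent_box 1 L" "e 0 = e0 0" for e
    using that e0 by (auto simp: exponent_box_def intro: PiE_ext[of _ "{..<1}"])
  have "rees_map f ?r
      = (\<Sum>e\<in>exponent_box 1 L. Polynomial.monom (c e * pderiv_germ j f ^ e 0) (e 0))"
    by (simp add: hom_sum[OF unital_hom_rees_map] hom_mult[OF unital_hom_rees_map] power_product_def
        hom_power[OF unital_hom_rees_map] rees_map_spconst rees_map_spvar monom_power smult_monom)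
  hence "Polynomial.coeff (rees_map f ?r) (e0 0)
      = (\<Sum>e\<in>exponent_box 1 L. if e = e0 then c e * pderiv_germ j f ^ e 0 else 0)"
    using inj by (auto simp: Polynomial.coeff_sum intro!: sum.cong)
  also have "\<dots> = c e0 * pderiv_germ j f ^ e0 0"
    using e0 by (simp add: finite_exponent_box)
  finally have "Polynomial.coeff (rees_map f ?r) (e0 0) = c e0 * pderiv_germ j f ^ e0 0" .
  moreover have "Polynomial.coeff (rees_map f ?r) (e0 0) \<in> q"
    using rel unfolding conormal_prime_def by blast
  ultimately have "c e0 * pderiv_germ j f ^ e0 0 \<in> q" by simp
  hence "c e0 \<in> q" using prime_mult[OF q] prime_power[OF q] j by blast
  thus "spconst (c e0) \<in> conormal_prime f q" by (simp add: spconst_in_conormal_prime_iff[OF q])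
  qed
qed

text \<open>
  Going down a chain of primes from \<open>conormal_prime f q\<close>, the contraction to the ring of germs is \<open>q\<close>
  and then \<open>0\<close>, since \<open>q\<close> has height one.  Each step adds an independent element, except the one step
  at which the contraction jumps.  The bottom of a chain of length \<open>k\<close> therefore carries
  at least \<open>1 + (k - 1)\<close> independent elements, and there are at most \<open>n + 1\<close>.
\<close>

lemma prime_height_conormal_prime_le:
  fixes f :: "'n::finite hgerm"
  assumes gc: "generic_component \<Delta> f q" and j: "pderiv_germ j f \<notin> q"
  shows "prime_height (conormal_prime f q) \<le> enat (CARD('n) + 1)"
  unfolding prime_height_def
proof (rule Sup_least, clarify)
  interpret generic_component \<Delta> f q by (fact gc)
  fix k C
  assume prime: "\<forall>i\<le>k. prime_ideal (C i)" and strict: "\<forall>i<k. C i \<subset> C (Suc i)"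
    and top: "C k = conormal_prime f q"
  define \<kappa> where "\<kappa> i = {c. spconst c \<in> C i}" for i
  have \<kappa>_prime: "prime_ideal (\<kappa> i)" if "i \<le> k" for i
    unfolding \<kappa>_def using prime that by (intro prime_ideal_preimage[OF unital_hom_spconst]) auto
  have \<kappa>_top: "\<kappa> k = q" by (simp add: \<kappa>_def top spconst_in_conormal_prime_iff[OF q])
  have \<kappa>_mono: "\<kappa> i \<subseteq> \<kappa> (Suc i)" if "i < k" for i
    using strict that by (auto simp: \<kappa>_def)
  have \<kappa>_le: "\<kappa> i \<subseteq> q" if "i \<le> k" for i
    using that by (induction i rule: inc_induct) (use \<kappa>_top \<kappa>_mono in auto)
  have \<kappa>_cases: "\<kappa> i = {0} \<or> \<kappa> i = q" if "i \<le> k" for i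
    using prime_below[OF \<kappa>_prime[OF that] \<kappa>_le[OF that]] by blast
  have chain: "\<exists>M h. alg_indep_mod spconst (C i) M h \<and> k - i + 1 \<le> M + (if \<kappa> i = q then 0 else 1)"
    if "i \<le> k" for i
    using that
  proof (induction i rule: inc_induct)
    case base
    show ?case using alg_indep_mod_conormal_prime[OF q j] \<kappa>_top
      by (intro exI[of _ 1] exI[of _ "\<lambda>_. spvar (Xi j)"]) (simp add: top)
  next
    case (step i)
    then obtain M h where indep: "alg_indep_mod spconst (C (Suc i)) M h"
      and M: "k - Suc i + 1 \<le> M + (if \<kappa> (Suc i) = q then 0 else 1)" by blast
    have Q: "prime_ideal (C i)" "prime_ideal (C (Suc i))" "C i \<subset> C (Suc i)"
      using prime strict step.hyps by auto
    show ?case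
    proof (cases "\<kappa> i = \<kappa> (Suc i)")
      case True
      hence contr: "spconst c \<in> C i" if "spconst c \<in> C (Suc i)" for c
        using that by (auto simp: \<kappa>_def)
      obtain u where "alg_indep_mod spconst (C i) (Suc M) (h(M := u))"
        using alg_indep_mod_extend[OF Q contr indep] by blast
      moreover have "k - i + 1 \<le> Suc M + (if \<kappa> i = q then 0 else 1)"
        using M True step.hyps by auto
      ultimately show ?thesis by blast
    next
      case False
      hence \<kappa>: "\<kappa> i = {0}" "\<kappa> (Suc i) = q"
        using \<kappa>_cases[of i] \<kappa>_cases[of "Suc i"] \<kappa>_mono[of i] ideal_zero[OF q_ideal] step.hyps
          prime_is_ideal[OF \<kappa>_prime[of i]] ideal_zero \<kappa>_le[of "Suc i"] by auto
      have "spconst c \<in> C i \<longleftrightarrow> c = 0" "spconst c \<in> C (Suc i) \<Longrightarrow> c \<in> q" for c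
        using \<kappa> by (auto simp: \<kappa>_def)
      hence "alg_indep_mod spconst (C i) M h"
        using Q indep by (intro alg_indep_mod_generic[OF unital_hom_spconst Q(1) _ _ _ indep]) auto
      moreover have "q \<noteq> {0}" using f_in f_nonzero by auto
      hence "k - i + 1 \<le> M + (if \<kappa> i = q then 0 else 1)" using M \<kappa> step.hyps by auto
      ultimately show ?thesis by blast
    qed
  qed
  obtain M h where "alg_indep_mod spconst (C 0) M h" "k + 1 \<le> M + (if \<kappa> 0 = q then 0 else 1)"
    using chain[of 0] by auto
  moreover have "M \<le> CARD('n) + 1"
    using prime \<kappa>_le[of 0] calculation(1)
    by (intro alg_indep_mod_bound[OF gc prime_is_ideal]) (auto simp: \<kappa>_def)
  ultimately show "enat k \<le> enat (CARD('n) + 1)" by (auto split: if_splits)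
qed


section \<open>The linear part of the Rees kernel\<close>

lemma module_smult_vec: "module ((*s) :: 'a::comm_ring_1 \<Rightarrow> 'a ^ 'n \<Rightarrow> 'a ^ 'n)"
  by unfold_locales (simp_all add: vec_eq_iff algebra_simps)

lemma rees_map_linear_form:
  "rees_map f (principal_symbol \<delta> - spconst \<alpha> * spvar Ess) = Polynomial.monom (vf_apply \<delta> f - \<alpha> * f) 1"
proof -
  note hom = unital_hom_rees_map[of f]
  have "rees_map f (principal_symbol \<delta>) = (\<Sum>j\<in>UNIV. Polynomial.monom (\<delta> $ j * pderiv_germ j f) 1)"
    by (simp add: principal_symbol_def hom_sum[OF hom] hom_mult[OF hom] rees_map_spconst rees_map_spvar smult_monom)
  also have "\<dots> = Polynomial.monom (vf_apply \<delta> f) 1"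
    by (simp add: poly_eq_iff Polynomial.coeff_sum vf_apply_def)
  finally show ?thesis
    by (simp add: hom_diff[OF hom] hom_mult[OF hom] rees_map_spconst rees_map_spvar smult_monom diff_monom)
qed

lemma saito_ideal_subset_conormal_prime:
  assumes q: "prime_ideal q" "f \<in> q"
  shows "saito_ideal f S \<subseteq> conormal_prime f q"
  unfolding saito_ideal_def
proof (rule ideal_of_subset[OF prime_is_ideal[OF prime_ideal_conormal_prime[OF q(1)]]])
  have "principal_symbol \<delta> - spconst \<alpha> * spvar Ess \<in> conormal_prime f q" if "vf_apply \<delta> f = \<alpha> * f" for \<delta> \<alpha>
    using rees_ker_subset_conormal_prime[OF q(1), of f] that
    by (auto simp: rees_ker_def rees_map_linear_form)
  thus "insert (spconst f) {principal_symbol \<delta> - spconst \<alpha> * spvar Ess |\<delta> \<alpha>. \<delta> \<in> S \<and> vf_apply \<delta> f = \<alpha> * f}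
      \<subseteq> conormal_prime f q"
    using q by (auto simp: spconst_in_conormal_prime_iff)
qed

lemma homogeneous_one_expand:
  fixes p :: "'n::finite symbol_poly"
  assumes "homogeneous 1 p"
  obtains \<delta> \<alpha> where "p = principal_symbol \<delta> - spconst \<alpha> * spvar Ess"
proof -
  define a where "a v = Poly_Mapping.lookup p (Poly_Mapping.single v 1)" for v
  define \<delta> :: "'n hgerm ^ 'n" where "\<delta> = (\<chi> j. a (Xi j))"
  have single_inj: "Poly_Mapping.single v (1::nat) = Poly_Mapping.single w 1 \<longleftrightarrow> v = w" for v w :: "'n symvar"
    by (metis lookup_single_eq lookup_single_not_eq one_neq_zero)
  have monomial: "Poly_Mapping.lookup (spconst c * spvar v) m = (if m = Poly_Mapping.single v 1 then c else 0)"
    for c :: "'n hgerm" and v m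
    by (auto simp: lookup_spconst_mult spvar_def lookup_single when_def)
  have expand: "Poly_Mapping.lookup (principal_symbol \<delta> - spconst (- a Ess) * spvar Ess) m
      = (\<Sum>j\<in>UNIV. if m = Poly_Mapping.single (Xi j) 1 then a (Xi j) else 0)
        + (if m = Poly_Mapping.single Ess 1 then a Ess else 0)" for m
    by (simp add: principal_symbol_def lookup_minus lookup_sum monomial \<delta>_def)
  have "Poly_Mapping.lookup p m = Poly_Mapping.lookup (principal_symbol \<delta> - spconst (- a Ess) * spvar Ess) m" for m
  proof (cases "\<exists>v. m = Poly_Mapping.single v 1")
    case True
    then obtain v where v: "m = Poly_Mapping.single v 1" by blast
    show ?thesis unfolding expand unfolding v single_inj
      by (cases v) (simp_all add: a_def)
  next
    case False
    have "m \<notin> Poly_Mapping.keys p"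
    proof
      assume "m \<in> Poly_Mapping.keys p"
      hence "(\<Sum>v\<in>Poly_Mapping.keys m. Poly_Mapping.lookup m v) = 1"
        using assms by (simp add: homogeneous_def)
      then obtain v where v: "v \<in> Poly_Mapping.keys m" "Poly_Mapping.lookup m v = 1"
        "\<forall>w\<in>Poly_Mapping.keys m. v \<noteq> w \<longrightarrow> Poly_Mapping.lookup m w = 0"
        unfolding sum_eq_1_iff[OF finite_keys] by (elim bexE conjE)
      have "m = Poly_Mapping.single v 1"
        using v by (intro poly_mapping_eqI) (auto simp: lookup_single when_def in_keys_iff)
      thus False using False by blast
    qed
    thus ?thesis using False unfolding expand by (simp add: in_keys_iff)
  qed
  hence "p = principal_symbol \<delta> - spconst (- a Ess) * spvar Ess" by (rule poly_mapping_eqI)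
  thus ?thesis by (rule that)
qed

lemma principal_symbol_add: "principal_symbol (\<delta> + \<delta>') = principal_symbol \<delta> + principal_symbol \<delta>'"
  by (simp add: principal_symbol_def hom_add[OF unital_hom_spconst] distrib_right sum.distrib)

lemma principal_symbol_smult: "principal_symbol (c *s \<delta>) = spconst c * principal_symbol \<delta>"
  by (simp add: principal_symbol_def hom_mult[OF unital_hom_spconst] sum_distrib_left mult.assoc)

lemma vf_apply_add: "vf_apply (\<delta> + \<delta>') f = vf_apply \<delta> f + vf_apply \<delta>' f"
  by (simp add: vf_apply_def distrib_right sum.distrib)

lemma vf_apply_smult: "vf_apply (c *s \<delta>) f = c * vf_apply \<delta> f"
  by (simp add: vf_apply_def sum_distrib_left mult.assoc)

text \<open>
  The linear forms in the kernel are the \<open>\<sigma>(\<delta>) - \<alpha> s\<close> with \<open>\<delta>(f) = \<alpha> f\<close>.  As \<open>\<alpha>\<close> is determined by \<open>\<delta>\<close>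
  when \<open>f \<noteq> 0\<close>, they depend linearly on \<open>\<delta>\<close>, so generators of the logarithmic vector fields give them all.
\<close>

lemma rees_ker1_subset_saito_ideal:
  fixes f :: "'n::finite hgerm"
  assumes f: "f \<noteq> 0" and S: "module.span (*s) S = log_derivations f"
  shows "rees_ker1 f \<subseteq> saito_ideal f S"
  unfolding rees_ker1_def
proof (rule ideal_of_subset)
  let ?I = "saito_ideal f S"
  show I: "is_ideal ?I" unfolding saito_ideal_def by (rule is_ideal_ideal_of)
  interpret V: module "(*s) :: 'n hgerm \<Rightarrow> 'n hgerm ^ 'n \<Rightarrow> 'n hgerm ^ 'n" by (rule module_smult_vec)
  define good where "good \<delta> \<longleftrightarrow> (\<exists>\<alpha>. vf_apply \<delta> f = \<alpha> * f \<and> principal_symbol \<delta> - spconst \<alpha> * spvar Ess \<in> ?I)" for \<delta>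
  have good: "good \<delta>" if "\<delta> \<in> log_derivations f" for \<delta>
    using that unfolding S[symmetric]
  proof (induction rule: V.span_induct_alt)
    case base
    have "principal_symbol 0 - spconst 0 * spvar Ess \<in> ?I"
      using ideal_zero[OF I] by (simp add: principal_symbol_def hom_zero[OF unital_hom_spconst])
    thus ?case unfolding good_def
      by (intro exI[of _ 0]) (simp add: vf_apply_def)
  next
    case (step c x y)
    have "x \<in> log_derivations f" using step V.span_base S by blast
    then obtain \<alpha> where \<alpha>: "vf_apply x f = \<alpha> * f"
      by (auto simp: log_derivations_def in_ideal_of_singleton_iff dvd_def mult.commute)
    have x: "principal_symbol x - spconst \<alpha> * spvar Ess \<in> ?I"
      unfolding saito_ideal_def using step(1) \<alpha> by (intro ideal_of_base) blast
    obtain \<beta> where \<beta>: "vf_apply y f = \<beta> * f" "principal_symbol y - spconst \<beta> * spvar Ess \<in> ?I"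
      using step by (auto simp: good_def)
    have "principal_symbol (c *s x + y) - spconst (c * \<alpha> + \<beta>) * spvar Ess
        = spconst c * (principal_symbol x - spconst \<alpha> * spvar Ess) + (principal_symbol y - spconst \<beta> * spvar Ess)"
      by (simp add: principal_symbol_add principal_symbol_smult hom_add[OF unital_hom_spconst]
          hom_mult[OF unital_hom_spconst] algebra_simps)
    also have "\<dots> \<in> ?I" by (intro ideal_add[OF I] ideal_mult_left[OF I] x \<beta>)
    finally show ?case unfolding good_def
      by (intro exI[of _ "c * \<alpha> + \<beta>"]) (simp add: vf_apply_add vf_apply_smult \<alpha> \<beta> algebra_simps)
  qed
  show "{P \<in> rees_ker f. homogeneous 1 P} \<subseteq> ?I"
  proof
    fix p assume "p \<in> {P \<in> rees_ker f. homogeneous 1 P}"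
    hence p: "rees_map f p = 0" "homogeneous 1 p" by (auto simp: rees_ker_def)
    obtain \<delta> \<alpha> where p_eq: "p = principal_symbol \<delta> - spconst \<alpha> * spvar Ess"
      by (rule homogeneous_one_expand[OF p(2)])
    have \<alpha>: "vf_apply \<delta> f = \<alpha> * f" using p(1) by (simp add: p_eq rees_map_linear_form)
    hence "\<delta> \<in> log_derivations f" by (simp add: log_derivations_def in_ideal_of_singleton_iff)
    then obtain \<beta> where \<beta>: "vf_apply \<delta> f = \<beta> * f" "principal_symbol \<delta> - spconst \<beta> * spvar Ess \<in> ?I"
      using good by (auto simp: good_def)
    thus "p \<in> ?I" using \<alpha> f p_eq by simp
  qed
qed

text \<open>
  The Saito ideal is generated by the Rees kernel and \<open>f\<close>, so every prime over it is strictly above the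
  top of the chain of \<open>prime_height_over_rees_kernel\<close>.  A generic component gives a prime over it at
  which the height is attained.
\<close>

theorem height_saito_ideal:
  fixes f :: "'n::finite hgerm"
  assumes f: "f \<noteq> 0" "germ_value f = 0"
    and reduced: "\<And>h k. h ^ k \<in> ideal_of {f} \<Longrightarrow> h \<in> ideal_of {f}"
    and linear: "rees_ker f = rees_ker1 f"
    and S: "module.span (*s) S = log_derivations f"
  shows "height (saito_ideal f S) = enat (CARD('n) + 1)"
proof (rule antisym)
  obtain q where gc: "generic_component (range (pderiv_germ :: 'n \<Rightarrow> _)) f q"
    using generic_component_exists[OF germs_differentially_simple f(1)] f(2) reduced
    by (auto simp: germ_dvd_one_iff in_ideal_of_singleton_iff)
  interpret generic_component "range (pderiv_germ :: 'n \<Rightarrow> _)" f q by (fact gc)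
  obtain j where "pderiv_germ j f \<notin> q" using derivative_notin by blast
  hence "prime_height (conormal_prime f q) \<le> enat (CARD('n) + 1)"
    by (rule prime_height_conormal_prime_le[OF gc])
  moreover have "height (saito_ideal f S) \<le> prime_height (conormal_prime f q)"
    unfolding height_def
    using prime_ideal_conormal_prime[OF q] saito_ideal_subset_conormal_prime[OF q f_in]
    by (intro Inf_lower) blast
  ultimately show "height (saito_ideal f S) \<le> enat (CARD('n) + 1)" by order
next
  show "enat (CARD('n) + 1) \<le> height (saito_ideal f S)"
    unfolding height_def
  proof (rule Inf_greatest, clarify)
    fix P assume P: "prime_ideal P" "saito_ideal f S \<subseteq> P"
    have "spconst f \<in> saito_ideal f S" unfolding saito_ideal_def by (intro ideal_of_base) simp
    moreover have "rees_ker f \<subseteq> saito_ideal f S"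
      unfolding linear by (rule rees_ker1_subset_saito_ideal[OF f(1) S])
    ultimately show "enat (CARD('n) + 1) \<le> prime_height P"
      using P by (intro prime_height_over_rees_kernel[OF f(1)]) auto
  qed
qed

theorem proposition4p14:
  fixes X :: "'a topology"
    and A :: "('a set \<times> ('a \<Rightarrow> complex^'n::finite)) set"
    and D :: "'a set"
  assumes "complex_manifold X A"
    and "divisor X A D"
    and "linear_jacobian_type X A D"
  shows "strongly_saito_holonomic X A D"
  unfolding strongly_saito_holonomic_def strongly_saito_holonomic_at_def
proof (intro ballI allI impI, elim conjE)
  fix p c and f :: "'n hgerm" and S
  assume p: "p \<in> D" and c: "local_coordinates X A p c" and f: "reduced_local_equation D c f"
    and S: "module.span (*s) S = log_derivations f"
  have "\<forall>\<^sub>F z in nhds 0. z \<in> snd c ` (fst c \<inter> D) \<longleftrightarrow> rep_hgerm f z = 0"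
    using f by (simp add: reduced_local_equation_def)
  from eventually_nhds_x_imp_x[OF this] have "0 \<in> snd c ` (fst c \<inter> D) \<longleftrightarrow> rep_hgerm f 0 = 0" .
  moreover have "0 \<in> snd c ` (fst c \<inter> D)"
    using c p by (auto simp: local_coordinates_def intro!: image_eqI[of _ _ p])
  ultimately have "germ_value f = 0"
    using germ_value_abs[OF hol_near0_rep_hgerm, of f] by simp
  moreover have "rees_ker f = rees_ker1 f"
    using assms(3) p c f unfolding linear_jacobian_type_def by blast
  ultimately show "height (saito_ideal f S) = enat (CARD('n) + 1)"
    using f S by (intro height_saito_ideal) (auto simp: reduced_local_equation_def)
qed

end
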